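(* Assume the Gaussian limit-layer hypotheses stated in the context for the $N\times N$ trained limit layer $W_2^*(N)=S_2^*(N)+R_2^*(N)$. Let $\sigma_1^*(N)\ge\sigma_2^*(N)\ge\cdots$ be the singular values of $S_2^*(N)$. Fix $k\ge1$ and let $\delta_k(N)=\sigma_k^*(N)-\sigma_{k+1}^*(N)$. If $\mathbb P(\delta_k(N)>0)\to1$ and $$\frac{\|R_2^*(N)\|_{\mathrm{op}}}{\delta_k(N)}\to0\quad\text{in probability},$$ then the orthogonal projectors onto the top-$k$ left and right singular subspaces of $W_2^*(N)$ converge in operator norm to those of $S_2^*(N)$, i.e. the operator norms of the differences of the corresponding projectors tend to $0$ in probability as $N\to\infty$.
   Context: Setting. For each $N$ there is a classifier network $\phi(\cdot,\alpha)=\rho\circ X(\cdot,\alpha)$ with $K$ classes and weight matrices $W_i$; $\rho(v)_i=e^{v_i}/\sum_{j=1}^K e^{v_j}$, $X(s,\alpha)\in\mathbb R^K$ are the logits. $T$ is a finite nonempty training set, fixed independently of $N$, with correct classes $C(s)\in\{1,\dots,K\}$. For $\lambda_{\mathrm{reg}}>0$ the loss is $$L(\alpha)=-\frac1{|T|}\sum_{s\in T}\log\big(\phi_{C(s)}(s,\alpha)\big)+\lambda_{\mathrm{reg}}\sum_i\|W_i\|_F^2 .$$ Gaussian limit-layer hypotheses. (i) For each $N$ the random training path $\alpha(t,N)$ converges in probability as $t\to\infty$ to $\alpha^*(N)$, whose distinguished $N\times N$ layer matrix is $W_2^*(N)=S_2^*(N)+R_2^*(N)$. At $\alpha^*(N)$,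 $\phi=\rho\circ\psi_2\circ(R_2^*(N)+S_2^*(N))\circ\psi_1$, where $\psi_1$ (values in $\mathbb R^N$) and $\psi_2:\mathbb R^N\to\mathbb R^K$ may depend on $N$ and on the remaining parameters. (ii) Conditionally on $(S_2^*(N),\psi_1,\psi_2)$ the entries of $R_2^*(N)$ are iid $N(0,g_*(N)/N)$, with $g_*(N)\ge0$ deterministic. (iii) For each $s\in T$ there is a set $\mathcal U_s\supseteq\{(S_2^*(N)+\vartheta R_2^*(N))\psi_1(s):\vartheta\in[0,1]\}$ with $$L_{\psi_2}(s):=\sup_{v,w\in\mathcal U_s,\,v\ne w}\frac{\|\psi_2(v)-\psi_2(w)\|_\infty}{\|v-w\|_\infty}<\infty .$$ (iv) There are nonnegative $d_1(N),d_2(N)\to0$ and a nonnegative function $J(v)$ of $v$ only such that for every $v$ measurable with respect to $\sigma(S_2^*(N),\psi_1,\psi_2)$, $\mathbb P(\|R_2^*(N)v\|_\infty>d_1(N)J(v)\mid S_2^*(N),\psi_1,\psi_2)\le d_2(N)$. (v) With $a_\phi(N,s):=J(\psi_1(s))L_{\psi_2}(s)d_1(N)$, for all $s\in T$ one has $a_\phi(N,s)\to0$ as $N\to\infty$ (in probability if random). (vi) $\langle S_2^*(N),R_2^*(N)\rangle_F\to0$ in probability as $N\to\infty$. (vii) Let $\alpha^*_\vartheta(N)$ denote $\alpha^*(N)$ with $W_2^*(N)$ replaced by $S_2^*(N)+\vartheta R_2^*(N)$. There are nonnegative random variables $\epsilon_N\to0$ in probability such that the event $\liminf_{h\downarrow0}h^{-1}\big(L(\alpha^*_{1-h}(N))-L(\alpha^*(N))\big)\ge-\epsilon_N$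 has probability tending to one. The top-$k$ left (right) singular subspace is spanned by left (right) singular vectors for the $k$ largest singular values; on events where it is not uniquely determined any choice may be made. $\|\cdot\|_{\mathrm{op}}$ is the spectral norm; $\|\cdot\|_F$, $\langle\cdot,\cdot\rangle_F$ are the Frobenius norm and inner product; $\|\cdot\|_\infty$ of a vector is the maximum norm. *)

theory Defs
  imports "HOL-Probability.Probability" "Jordan_Normal_Form.VS_Connect" "Jordan_Normal_Form.Char_Poly"
begin

text \<open>The layer width \<open>N\<close> varies inside the statement, so matrices and vectors are those of
  \<open>Jordan_Normal_Form\<close>, whose dimensions are values; the type-indexed namesakes are hidden.\<close>

hide_type (open) Finite_Cartesian_Product.vec
hide_const (open) Finite_Cartesian_Product.vec Finite_Cartesian_Product.row
  Finite_Cartesian_Product.column Determinants.det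
unbundle no vec_syntax
no_notation inner (infix \<open>\<bullet>\<close> 70)


section \<open>Norms of vectors and matrices\<close>

definition l2_norm :: "real vec \<Rightarrow> real" where
  "l2_norm v = sqrt (scalar_prod v v)"

definition max_norm :: "real vec \<Rightarrow> real" where
  "max_norm v = Max (insert 0 {\<bar>v $ i\<bar> | i. i < dim_vec v})"

definition op_norm :: "real mat \<Rightarrow> real" where
  "op_norm A = Sup {l2_norm (A *\<^sub>v v) | v. v \<in> carrier_vec (dim_col A) \<and> l2_norm v \<le> 1}"

definition frob_inner :: "real mat \<Rightarrow> real mat \<Rightarrow> real" where
  "frob_inner A B = (\<Sum>i<dim_row A. \<Sum>j<dim_col A. A $$ (i, j) * B $$ (i, j))"

definition frob_norm :: "real mat \<Rightarrow> real" where
  "frob_norm A = sqrt (frob_inner A A)"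


section \<open>Singular values and singular subspaces\<close>

text \<open>The singular values of a square matrix are the nonnegative square roots of the eigenvalues of
  \<open>A\<^sup>T A\<close>, counted with multiplicity and listed in nonincreasing order.\<close>

definition singular_values :: "real mat \<Rightarrow> real list" where
  "singular_values A = (THE xs. sorted_wrt (\<ge>) xs \<and> (\<forall>x\<in>set xs. 0 \<le> x) \<and>
     char_poly (transpose_mat A * A) = (\<Prod>x\<leftarrow>xs. [:- (x\<^sup>2), 1:]))"

text \<open>\<open>sing_val A i\<close> is \<open>\<sigma>\<^sub>i\<close> with the index starting at \<open>1\<close>; it is \<open>0\<close> beyond the dimension.\<close>

definition sing_val :: "real mat \<Rightarrow> nat \<Rightarrow> real" where
  "sing_val A i =
     (if 1 \<le> i \<and> i \<le> length (singular_values A) then singular_values A ! (i - 1) else 0)"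

definition is_svd :: "real mat \<Rightarrow> real mat \<Rightarrow> (nat \<Rightarrow> real) \<Rightarrow> real mat \<Rightarrow> bool" where
  "is_svd A U s V \<longleftrightarrow> (let n = dim_row A in
     A \<in> carrier_mat n n \<and> U \<in> carrier_mat n n \<and> V \<in> carrier_mat n n \<and>
     transpose_mat U * U = 1\<^sub>m n \<and> transpose_mat V * V = 1\<^sub>m n \<and>
     (\<forall>i<n. 0 \<le> s i) \<and> (\<forall>i j. i \<le> j \<longrightarrow> j < n \<longrightarrow> s j \<le> s i) \<and>
     A = U * mat n n (\<lambda>(i, j). if i = j then s i else 0) * transpose_mat V)"

definition is_orth_projector :: "nat \<Rightarrow> real vec set \<Rightarrow> real mat \<Rightarrow> bool" where
  "is_orth_projector n W P \<longleftrightarrow>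
     P \<in> carrier_mat n n \<and> P * P = P \<and> transpose_mat P = P \<and>
     (\<lambda>x. P *\<^sub>v x) ` carrier_vec n = W"

abbreviation vec_span :: "nat \<Rightarrow> real vec set \<Rightarrow> real vec set" where
  "vec_span n \<equiv> LinearCombinations.module.span class_ring (module_vec TYPE(real) n)"

text \<open>As the top-\<open>k\<close> subspaces need not be unique, the projectors are described by predicates
  that admit every choice of singular vectors.\<close>

definition top_left_projector :: "nat \<Rightarrow> real mat \<Rightarrow> real mat \<Rightarrow> bool" where
  "top_left_projector k A P \<longleftrightarrow>
     (\<exists>U s V. is_svd A U s V \<and>
        is_orth_projector (dim_row A) (vec_span (dim_row A) (set (take k (cols U)))) P)"

definition top_right_projector :: "nat \<Rightarrow> real mat \<Rightarrow> real mat \<Rightarrow> bool" where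
  "top_right_projector k A P \<longleftrightarrow>
     (\<exists>U s V. is_svd A U s V \<and>
        is_orth_projector (dim_row A) (vec_span (dim_row A) (set (take k (cols V)))) P)"


section \<open>Probabilistic notions\<close>

text \<open>Convergence to \<open>0\<close> in probability; the probability space may change with the index. The outer
  measure coincides with the probability on events, and it gives a meaning to the notion for
  suprema and for arbitrary choices of singular subspaces, which need not be measurable.\<close>

definition vanishes_in_prob ::
    "('i \<Rightarrow> 'w measure) \<Rightarrow> ('i \<Rightarrow> 'w \<Rightarrow> real) \<Rightarrow> 'i filter \<Rightarrow> bool" where
  "vanishes_in_prob M Y F \<longleftrightarrow>
     (\<forall>e>0. ((\<lambda>i. outer_measure_of (M i) {\<omega> \<in> space (M i). e < \<bar>Y i \<omega>\<bar>}) \<longlongrightarrow> 0) F)"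

definition sigma_generated :: "'w set \<Rightarrow> ('w \<Rightarrow> real) set \<Rightarrow> 'w measure" where
  "sigma_generated \<Omega> Ys = sigma \<Omega> {Y -` B \<inter> \<Omega> | Y B. Y \<in> Ys \<and> B \<in> sets borel}"

definition cond_prob_given :: "'w measure \<Rightarrow> 'w measure \<Rightarrow> 'w set \<Rightarrow> 'w \<Rightarrow> real" where
  "cond_prob_given M G E = real_cond_exp M G (indicator E)"

definition centered_normal :: "real \<Rightarrow> real measure" where
  "centered_normal v =
     (if v = 0 then return borel 0 else density lborel (normal_density 0 (sqrt v)))"


section \<open>Classifier networks\<close>

text \<open>Network parameters: the distinguished layer matrix, and the remaining parameters, i.e. the
  other weight matrices and any parameters that are not weight matrices (for example biases).\<close>

record remaining_params =
  weights :: "real mat list"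
  non_weights :: "real vec"

record params =
  layer :: "real mat"
  others :: remaining_params

definition remaining_space :: "(nat \<times> nat) list \<Rightarrow> nat \<Rightarrow> remaining_params set" where
  "remaining_space ds q = {r. length (weights r) = length ds \<and>
     (\<forall>l<length ds. weights r ! l \<in> carrier_mat (fst (ds ! l)) (snd (ds ! l))) \<and>
     non_weights r \<in> carrier_vec q}"

definition param_space :: "nat \<Rightarrow> (nat \<times> nat) list \<Rightarrow> nat \<Rightarrow> params set" where
  "param_space n ds q = {a. layer a \<in> carrier_mat n n \<and> others a \<in> remaining_space ds q}"

text \<open>The Euclidean distance of the tuples of all entries.\<close>

definition param_dist :: "params \<Rightarrow> params \<Rightarrow> real" where
  "param_dist a b = sqrt ((frob_norm (layer a - layer b))\<^sup>2 +
     (\<Sum>l<length (weights (others a)).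
        (frob_norm (weights (others a) ! l - weights (others b) ! l))\<^sup>2) +
     (l2_norm (non_weights (others a) - non_weights (others b)))\<^sup>2)"

definition random_mat :: "'w measure \<Rightarrow> nat \<Rightarrow> nat \<Rightarrow> ('w \<Rightarrow> real mat) \<Rightarrow> bool" where
  "random_mat M m n A \<longleftrightarrow> (\<forall>\<omega>\<in>space M. A \<omega> \<in> carrier_mat m n) \<and>
     (\<forall>i<m. \<forall>j<n. (\<lambda>\<omega>. A \<omega> $$ (i, j)) \<in> borel_measurable M)"

definition random_vec :: "'w measure \<Rightarrow> nat \<Rightarrow> ('w \<Rightarrow> real vec) \<Rightarrow> bool" where
  "random_vec M n v \<longleftrightarrow> (\<forall>\<omega>\<in>space M. v \<omega> \<in> carrier_vec n) \<and>
     (\<forall>i<n. (\<lambda>\<omega>. v \<omega> $ i) \<in> borel_measurable M)"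

definition random_params ::
    "'w measure \<Rightarrow> nat \<Rightarrow> (nat \<times> nat) list \<Rightarrow> nat \<Rightarrow> ('w \<Rightarrow> params) \<Rightarrow> bool" where
  "random_params M n ds q a \<longleftrightarrow>
     (\<forall>\<omega>\<in>space M. a \<omega> \<in> param_space n ds q) \<and>
     random_mat M n n (\<lambda>\<omega>. layer (a \<omega>)) \<and>
     (\<forall>l<length ds. random_mat M (fst (ds ! l)) (snd (ds ! l)) (\<lambda>\<omega>. weights (others (a \<omega>)) ! l)) \<and>
     random_vec M q (\<lambda>\<omega>. non_weights (others (a \<omega>)))"

definition softmax :: "nat \<Rightarrow> real vec \<Rightarrow> real vec" where
  "softmax K v = Matrix.vec K (\<lambda>i. exp (v $ i) / (\<Sum>j<K. exp (v $ j)))"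

text \<open>The classifier with logit map \<open>X\<close>; classes are numbered \<open>0, \<dots>, K - 1\<close>.\<close>

definition classifier ::
    "nat \<Rightarrow> ('s \<Rightarrow> params \<Rightarrow> real vec) \<Rightarrow> 's \<Rightarrow> params \<Rightarrow> real vec" where
  "classifier K X s a = softmax K (X s a)"

definition loss ::
    "nat \<Rightarrow> 's set \<Rightarrow> ('s \<Rightarrow> nat) \<Rightarrow> real \<Rightarrow> ('s \<Rightarrow> params \<Rightarrow> real vec) \<Rightarrow> params \<Rightarrow> real" where
  "loss K T C lam X a =
     - (1 / real (card T)) * (\<Sum>s\<in>T. ln (classifier K X s a $ C s)) +
     lam * ((frob_norm (layer a))\<^sup>2 + (\<Sum>W\<leftarrow>weights (others a). (frob_norm W)\<^sup>2))"

text \<open>The ratios are nonnegative, so inserting \<open>0\<close> only matters when \<open>A\<close> has at most one point.\<close>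

definition max_norm_ratios :: "(real vec \<Rightarrow> real vec) \<Rightarrow> real vec set \<Rightarrow> real set" where
  "max_norm_ratios f A =
     insert 0 {max_norm (f v - f w) / max_norm (v - w) | v w. v \<in> A \<and> w \<in> A \<and> v \<noteq> w}"

text \<open>The setting for all widths \<open>N \<ge> 1\<close>. The shapes \<open>ds N\<close> and \<open>q N\<close> of the remaining parameters
  are arbitrary, \<open>path N t\<close> is the training path (in discrete or continuous time) and \<open>astar N\<close> its
  limit. The maps \<open>psi1 N\<close> and \<open>psi2 N\<close> are functions of the remaining parameters.\<close>

locale limit_layer_network =
  fixes M :: "nat \<Rightarrow> 'w measure"
    and T :: "'s set" and C :: "'s \<Rightarrow> nat" and K :: nat and lam :: real
    and ds :: "nat \<Rightarrow> (nat \<times> nat) list" and q :: "nat \<Rightarrow> nat"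
    and X :: "nat \<Rightarrow> 's \<Rightarrow> params \<Rightarrow> real vec"
    and path :: "nat \<Rightarrow> 't::{linorder, no_top} \<Rightarrow> 'w \<Rightarrow> params"
    and astar :: "nat \<Rightarrow> 'w \<Rightarrow> params"
    and S R :: "nat \<Rightarrow> 'w \<Rightarrow> real mat"
    and psi1 :: "nat \<Rightarrow> remaining_params \<Rightarrow> 's \<Rightarrow> real vec"
    and psi2 :: "nat \<Rightarrow> remaining_params \<Rightarrow> real vec \<Rightarrow> real vec"
  assumes prob_spaces: "\<And>N. 1 \<le> N \<Longrightarrow> prob_space (M N)"
    and training_set: "finite T" "T \<noteq> {}"
    and classes: "\<And>s. s \<in> T \<Longrightarrow> C s < K"
    and regularization: "0 < lam"
    and logits: "\<And>N s a. 1 \<le> N \<Longrightarrow> a \<in> param_space N (ds N) (q N) \<Longrightarrow> X N s a \<in> carrier_vec K"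
    and random_path: "\<And>N t. 1 \<le> N \<Longrightarrow> random_params (M N) N (ds N) (q N) (path N t)"
    and random_limit: "\<And>N. 1 \<le> N \<Longrightarrow> random_params (M N) N (ds N) (q N) (astar N)"
    and random_S: "\<And>N. 1 \<le> N \<Longrightarrow> random_mat (M N) N N (S N)"
    and random_R: "\<And>N. 1 \<le> N \<Longrightarrow> random_mat (M N) N N (R N)"
    and psi1_dim: "\<And>N r s. 1 \<le> N \<Longrightarrow> r \<in> remaining_space (ds N) (q N) \<Longrightarrow>
          psi1 N r s \<in> carrier_vec N"
    and psi2_dim: "\<And>N r v. 1 \<le> N \<Longrightarrow> r \<in> remaining_space (ds N) (q N) \<Longrightarrow>
          v \<in> carrier_vec N \<Longrightarrow> psi2 N r v \<in> carrier_vec K"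
    and random_psi1: "\<And>N s. 1 \<le> N \<Longrightarrow>
          random_vec (M N) N (\<lambda>\<omega>. psi1 N (others (astar N \<omega>)) s)"
    and random_psi2: "\<And>N v. 1 \<le> N \<Longrightarrow> v \<in> carrier_vec N \<Longrightarrow>
          random_vec (M N) K (\<lambda>\<omega>. psi2 N (others (astar N \<omega>)) v)"
begin

definition Psi1 :: "nat \<Rightarrow> 'w \<Rightarrow> 's \<Rightarrow> real vec" where
  "Psi1 N \<omega> = psi1 N (others (astar N \<omega>))"

definition Psi2 :: "nat \<Rightarrow> 'w \<Rightarrow> real vec \<Rightarrow> real vec" where
  "Psi2 N \<omega> = psi2 N (others (astar N \<omega>))"

text \<open>\<open>\<sigma>(S, \<psi>\<^sub>1, \<psi>\<^sub>2)\<close>, the random functions being observed through all their values.\<close>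

definition info :: "nat \<Rightarrow> 'w measure" where
  "info N = sigma_generated (space (M N))
     ({\<lambda>\<omega>. S N \<omega> $$ (i, j) | i j. i < N \<and> j < N} \<union>
      {\<lambda>\<omega>. Psi1 N \<omega> s $ i | s i. i < N} \<union>
      {\<lambda>\<omega>. Psi2 N \<omega> v $ i | v i. v \<in> carrier_vec N \<and> i < K})"

text \<open>The parameters \<open>\<alpha>\<^sup>*\<^sub>\<theta>\<close> with the noise in the distinguished layer scaled by \<open>th\<close>.\<close>

definition astar_scaled :: "nat \<Rightarrow> real \<Rightarrow> 'w \<Rightarrow> params" where
  "astar_scaled N th \<omega> = astar N \<omega> \<lparr>layer := S N \<omega> + th \<cdot>\<^sub>m R N \<omega>\<rparr>"

end

text \<open>\<open>measure\<close> is \<open>0\<close> outside \<open>sets\<close>, so convergence of the measure of a set to \<open>1\<close> includes that the set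
  is an event from some \<open>N\<close> on. Similarly \<open>real_cond_exp\<close> is \<open>0\<close> for non-measurable functions, whence
  the explicit measurability in \<open>concentration\<close>.\<close>

locale gaussian_limit_layer =
  limit_layer_network M T C K lam ds q X path astar S R psi1 psi2
  for M :: "nat \<Rightarrow> 'w measure"
    and T :: "'s set" and C :: "'s \<Rightarrow> nat" and K :: nat and lam :: real
    and ds :: "nat \<Rightarrow> (nat \<times> nat) list" and q :: "nat \<Rightarrow> nat"
    and X :: "nat \<Rightarrow> 's \<Rightarrow> params \<Rightarrow> real vec"
    and path :: "nat \<Rightarrow> 't::{linorder, no_top} \<Rightarrow> 'w \<Rightarrow> params"
    and astar :: "nat \<Rightarrow> 'w \<Rightarrow> params"
    and S R :: "nat \<Rightarrow> 'w \<Rightarrow> real mat"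
    and psi1 :: "nat \<Rightarrow> remaining_params \<Rightarrow> 's \<Rightarrow> real vec"
    and psi2 :: "nat \<Rightarrow> remaining_params \<Rightarrow> real vec \<Rightarrow> real vec" +
  fixes g :: "nat \<Rightarrow> real"
    and U :: "nat \<Rightarrow> 'w \<Rightarrow> 's \<Rightarrow> real vec set"
    and d1 d2 :: "nat \<Rightarrow> real"
    and J :: "real vec \<Rightarrow> real"
    and eps :: "nat \<Rightarrow> 'w \<Rightarrow> real"
  assumes path_converges: "\<And>N. 1 \<le> N \<Longrightarrow>
      vanishes_in_prob (\<lambda>_. M N) (\<lambda>t \<omega>. param_dist (path N t \<omega>) (astar N \<omega>)) at_top"
    and layer_decomposition: "\<And>N \<omega>. 1 \<le> N \<Longrightarrow> \<omega> \<in> space (M N) \<Longrightarrow>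
      layer (astar N \<omega>) = S N \<omega> + R N \<omega>"
    and factorization: "\<And>N. 1 \<le> N \<Longrightarrow> AE \<omega> in M N. \<forall>s.
      classifier K (X N) s (astar N \<omega>) =
        softmax K (Psi2 N \<omega> ((R N \<omega> + S N \<omega>) *\<^sub>v Psi1 N \<omega> s))"
    and variance_nonneg: "\<And>N. 1 \<le> N \<Longrightarrow> 0 \<le> g N"
    and conditional_law: "\<And>N B. 1 \<le> N \<Longrightarrow> (\<And>i j. B i j \<in> sets borel) \<Longrightarrow>
      AE \<omega> in M N.
        cond_prob_given (M N) (info N)
          {\<omega>' \<in> space (M N). \<forall>i<N. \<forall>j<N. R N \<omega>' $$ (i, j) \<in> B i j} \<omega> =
        (\<Prod>i<N. \<Prod>j<N. measure (centered_normal (g N / real N)) (B i j))"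
    and segment: "\<And>N. 1 \<le> N \<Longrightarrow> AE \<omega> in M N. \<forall>s\<in>T.
      {(S N \<omega> + th \<cdot>\<^sub>m R N \<omega>) *\<^sub>v Psi1 N \<omega> s | th. th \<in> {0..1}} \<subseteq> U N \<omega> s \<and>
      U N \<omega> s \<subseteq> carrier_vec N"
    and lipschitz: "\<And>N. 1 \<le> N \<Longrightarrow> AE \<omega> in M N. \<forall>s\<in>T.
      bdd_above (max_norm_ratios (Psi2 N \<omega>) (U N \<omega> s))"
    and d_nonneg: "\<And>N. 1 \<le> N \<Longrightarrow> 0 \<le> d1 N" "\<And>N. 1 \<le> N \<Longrightarrow> 0 \<le> d2 N"
    and d_limits: "d1 \<longlonglongrightarrow> 0" "d2 \<longlonglongrightarrow> 0"
    and J_nonneg: "\<And>v. 0 \<le> J v"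
    and concentration: "\<And>N v. 1 \<le> N \<Longrightarrow> random_vec (info N) N v \<Longrightarrow>
      {\<omega> \<in> space (M N). max_norm (R N \<omega> *\<^sub>v v \<omega>) > d1 N * J (v \<omega>)} \<in> sets (M N) \<and>
      (AE \<omega> in M N.
        cond_prob_given (M N) (info N)
          {\<omega>' \<in> space (M N). max_norm (R N \<omega>' *\<^sub>v v \<omega>') > d1 N * J (v \<omega>')} \<omega> \<le> d2 N)"
    and sensitivity: "\<And>s. s \<in> T \<Longrightarrow>
      vanishes_in_prob M
        (\<lambda>N \<omega>. J (Psi1 N \<omega> s) * Sup (max_norm_ratios (Psi2 N \<omega>) (U N \<omega> s)) * d1 N) sequentially"
    and asymptotic_orthogonality:
      "vanishes_in_prob M (\<lambda>N \<omega>. frob_inner (S N \<omega>) (R N \<omega>)) sequentially"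
    and eps_random: "\<And>N. 1 \<le> N \<Longrightarrow> eps N \<in> borel_measurable (M N)"
    and eps_nonneg: "\<And>N \<omega>. 1 \<le> N \<Longrightarrow> \<omega> \<in> space (M N) \<Longrightarrow> 0 \<le> eps N \<omega>"
    and eps_vanishes: "vanishes_in_prob M eps sequentially"
    and almost_stationary:
      "(\<lambda>N. measure (M N) {\<omega> \<in> space (M N).
          Liminf (at_right 0) (\<lambda>h. ereal
            ((loss K T C lam (X N) (astar_scaled N (1 - h) \<omega>) -
              loss K T C lam (X N) (astar N \<omega>)) / h))
          \<ge> ereal (- eps N \<omega>)}) \<longlonglongrightarrow> 1"

end

theory Submission
  imports Defs
begin

text \<open>Let \<open>B = A + E\<close>, let \<open>P, Q\<close> and \<open>P', Q'\<close> be the top-\<open>k\<close> left and right projectors of \<open>A\<close> and \<open>B\<close>,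
  and put \<open>X = (1 - P') P\<close>, \<open>Y = (1 - Q') Q\<close>. Since \<open>A Q = P A\<close> and \<open>(1 - P') B = B (1 - Q')\<close>,
  one has \<open>X A = (1 - P') B Y - (1 - P') E Q\<close> on the range of \<open>Q\<close>. There \<open>A\<close> expands lengths by at
  least \<open>\<sigma>\<^sub>k(A)\<close>, and \<open>(1 - P') B\<close> has norm \<open>\<sigma>\<^sub>k\<^sub>+\<^sub>1(B) \<le> \<sigma>\<^sub>k\<^sub>+\<^sub>1(A) + \<parallel>E\<parallel>\<close> by Weyl's inequality, so
  \<open>\<sigma>\<^sub>k(A) \<parallel>X\<parallel> \<le> (\<sigma>\<^sub>k\<^sub>+\<^sub>1(A) + \<parallel>E\<parallel>) \<parallel>Y\<parallel> + \<parallel>E\<parallel>\<close>; transposing exchanges \<open>X\<close> and \<open>Y\<close>. As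
  \<open>\<parallel>X\<parallel>, \<parallel>Y\<parallel> \<le> 1\<close>, both are at most \<open>2 \<parallel>E\<parallel> / \<delta>\<^sub>k\<close>, and so are the norms with the roles of \<open>A\<close>
  and \<open>B\<close> exchanged. Hence \<open>\<parallel>P' - P\<parallel> \<le> 4 \<parallel>E\<parallel> / \<delta>\<^sub>k\<close> wherever \<open>\<delta>\<^sub>k > 0\<close>, for every admissible
  choice of singular subspaces.\<close>


section \<open>The spectral norm\<close>

lemma l2_norm_eq_L2_set: "l2_norm v = L2_set (\<lambda>i. v $ i) {0..<dim_vec v}"
  by (simp add: l2_norm_def L2_set_def scalar_prod_def power2_eq_square)

lemma l2_norm_nonneg [simp]: "0 \<le> l2_norm v"
  by (simp add: l2_norm_eq_L2_set)

lemma l2_norm_zero [simp]: "l2_norm (0\<^sub>v n) = 0"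
  by (simp add: l2_norm_eq_L2_set L2_set_def)

lemma l2_norm_power2: "(l2_norm v)\<^sup>2 = v \<bullet> v"
  by (simp add: l2_norm_def scalar_prod_def sum_nonneg)

lemma l2_norm_eq_0_iff:
  assumes "v \<in> carrier_vec n"
  shows "l2_norm v = 0 \<longleftrightarrow> v = 0\<^sub>v n"
  using assms by (auto simp: l2_norm_eq_L2_set L2_set_eq_0_iff)

lemma l2_norm_smult [simp]: "l2_norm (c \<cdot>\<^sub>v v) = \<bar>c\<bar> * l2_norm v"
proof -
  have "l2_norm (c \<cdot>\<^sub>v v) = sqrt (c\<^sup>2 * (v \<bullet> v))"
    by (simp add: l2_norm_def power2_eq_square mult.assoc)
  then show ?thesis by (simp add: real_sqrt_mult l2_norm_def)
qed

lemma l2_norm_triangle: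
  assumes "v \<in> carrier_vec n" "w \<in> carrier_vec n"
  shows "l2_norm (v + w) \<le> l2_norm v + l2_norm w"
  using assms L2_set_triangle_ineq[of "\<lambda>i. v $ i" "\<lambda>i. w $ i" "{0..<n}"]
  by (simp add: l2_norm_eq_L2_set L2_set_def)

lemma l2_norm_uminus [simp]: "l2_norm (- v) = l2_norm v"
  by (simp add: l2_norm_def)

lemma abs_scalar_prod_le:
  assumes "v \<in> carrier_vec n" "w \<in> carrier_vec n"
  shows "\<bar>v \<bullet> w\<bar> \<le> l2_norm v * l2_norm w"
proof -
  have "\<bar>v \<bullet> w\<bar> \<le> (\<Sum>i = 0..<n. \<bar>v $ i\<bar> * \<bar>w $ i\<bar>)"
    using assms by (auto simp: scalar_prod_def abs_mult[symmetric])
  also have "\<dots> \<le> l2_norm v * l2_norm w"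
    using assms L2_set_mult_ineq[of "\<lambda>i. v $ i" "\<lambda>i. w $ i" "{0..<n}"]
    by (simp add: l2_norm_eq_L2_set)
  finally show ?thesis .
qed

text \<open>Each coordinate of \<open>A *\<^sub>v v\<close> is a scalar product with a row, so
  Cauchy-Schwarz and the bound of the Euclidean norm by the sum norm give a crude constant. It
  serves to make the supremum defining \<open>op_norm\<close> finite.\<close>

lemma l2_norm_mult_mat_vec_bounded:
  assumes "A \<in> carrier_mat m n"
  obtains C where "0 \<le> C" "\<And>v. v \<in> carrier_vec n \<Longrightarrow> l2_norm (A *\<^sub>v v) \<le> C * l2_norm v"
proof
  show "0 \<le> (\<Sum>i = 0..<m. l2_norm (row A i))"
    by (simp add: sum_nonneg)
  fix v :: "real vec" assume v: "v \<in> carrier_vec n"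
  have "l2_norm (A *\<^sub>v v) \<le> (\<Sum>i = 0..<m. \<bar>(A *\<^sub>v v) $ i\<bar>)"
    using assms L2_set_le_sum_abs[of "\<lambda>i. (A *\<^sub>v v) $ i" "{0..<m}"]
    by (simp add: l2_norm_eq_L2_set)
  also have "\<dots> \<le> (\<Sum>i = 0..<m. l2_norm (row A i) * l2_norm v)"
    using assms v by (intro sum_mono) (auto intro!: abs_scalar_prod_le[of _ n])
  finally show "l2_norm (A *\<^sub>v v) \<le> (\<Sum>i = 0..<m. l2_norm (row A i)) * l2_norm v"
    by (simp add: sum_distrib_right)
qed

lemma op_norm_bdd_above:
  "bdd_above {l2_norm (A *\<^sub>v v) | v. v \<in> carrier_vec (dim_col A) \<and> l2_norm v \<le> 1}"
proof -
  obtain C where C: "0 \<le> C"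
    "\<And>v. v \<in> carrier_vec (dim_col A) \<Longrightarrow> l2_norm (A *\<^sub>v v) \<le> C * l2_norm v"
    using l2_norm_mult_mat_vec_bounded[of A "dim_row A" "dim_col A"] by auto
  have "l2_norm (A *\<^sub>v v) \<le> C" if "v \<in> carrier_vec (dim_col A)" "l2_norm v \<le> 1" for v
    using C(2)[OF that(1)] mult_left_mono[OF that(2) C(1)] by simp
  then show ?thesis by (auto intro!: bdd_aboveI)
qed

lemma op_norm_nonneg [simp]: "0 \<le> op_norm A"
  unfolding op_norm_def
  by (rule cSup_upper2[OF _ _ op_norm_bdd_above, of 0])
     (auto intro!: exI[of _ "0\<^sub>v (dim_col A)"] simp: l2_norm_eq_L2_set L2_set_def)

lemma l2_norm_mult_mat_vec_le:
  assumes A: "A \<in> carrier_mat m n" and v: "v \<in> carrier_vec n"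
  shows "l2_norm (A *\<^sub>v v) \<le> op_norm A * l2_norm v"
proof (cases "l2_norm v = 0")
  case True
  then have "v = 0\<^sub>v n" using v by (simp add: l2_norm_eq_0_iff)
  moreover have "A *\<^sub>v 0\<^sub>v n = 0\<^sub>v m" using A by auto
  ultimately show ?thesis by simp
next
  case False
  then have pos: "0 < l2_norm v" by (simp add: less_le)
  let ?w = "(1 / l2_norm v) \<cdot>\<^sub>v v"
  have "l2_norm (A *\<^sub>v ?w) \<le> op_norm A"
    unfolding op_norm_def
    by (rule cSup_upper[OF _ op_norm_bdd_above]) (use A v pos in \<open>auto intro!: exI[of _ ?w]\<close>)
  moreover have "l2_norm (A *\<^sub>v ?w) = l2_norm (A *\<^sub>v v) / l2_norm v"
    using A v pos by (subst mult_mat_vec) auto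
  ultimately show ?thesis using pos by (simp add: field_simps)
qed

lemma op_norm_le:
  assumes A: "A \<in> carrier_mat m n" and "0 \<le> c"
    and le: "\<And>v. v \<in> carrier_vec n \<Longrightarrow> l2_norm (A *\<^sub>v v) \<le> c * l2_norm v"
  shows "op_norm A \<le> c"
  unfolding op_norm_def
proof (rule cSup_least)
  show "{l2_norm (A *\<^sub>v v) |v. v \<in> carrier_vec (dim_col A) \<and> l2_norm v \<le> 1} \<noteq> {}"
    by (auto intro!: exI[of _ "0\<^sub>v (dim_col A)"])
next
  fix x assume "x \<in> {l2_norm (A *\<^sub>v v) |v. v \<in> carrier_vec (dim_col A) \<and> l2_norm v \<le> 1}"
  then obtain v where v: "v \<in> carrier_vec n" "l2_norm v \<le> 1" "x = l2_norm (A *\<^sub>v v)"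
    using A by auto
  show "x \<le> c" using le[OF v(1)] mult_left_mono[OF v(2) \<open>0 \<le> c\<close>] v(3) by simp
qed

lemma op_norm_mult_le:
  assumes A: "A \<in> carrier_mat l m" and B: "B \<in> carrier_mat m n"
  shows "op_norm (A * B) \<le> op_norm A * op_norm B"
proof (rule op_norm_le)
  show "A * B \<in> carrier_mat l n" using A B by simp
  fix v :: "real vec" assume v: "v \<in> carrier_vec n"
  have "l2_norm (A * B *\<^sub>v v) = l2_norm (A *\<^sub>v (B *\<^sub>v v))"
    using assoc_mult_mat_vec[OF A B v] by simp
  also have "\<dots> \<le> op_norm A * l2_norm (B *\<^sub>v v)"
    using A B v by (intro l2_norm_mult_mat_vec_le) auto
  also have "\<dots> \<le> op_norm A * (op_norm B * l2_norm v)"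
    using B v by (intro mult_left_mono l2_norm_mult_mat_vec_le) auto
  finally show "l2_norm (A * B *\<^sub>v v) \<le> op_norm A * op_norm B * l2_norm v"
    by (simp add: mult.assoc)
qed simp

lemma op_norm_uminus [simp]: "op_norm (- A) = op_norm A"
proof -
  have "l2_norm (- A *\<^sub>v v) = l2_norm (A *\<^sub>v v)" if "v \<in> carrier_vec (dim_col A)" for v
    using that by simp
  then show ?thesis
    unfolding op_norm_def by (intro arg_cong[where f = Sup] Collect_cong ex_cong1) auto
qed

lemma op_norm_diff_le:
  assumes A: "A \<in> carrier_mat m n" and B: "B \<in> carrier_mat m n"
  shows "op_norm (A - B) \<le> op_norm A + op_norm B"
proof (rule op_norm_le)
  show "A - B \<in> carrier_mat m n" using A B by auto
  fix v :: "real vec" assume v: "v \<in> carrier_vec n"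
  have "(A - B) *\<^sub>v v = A *\<^sub>v v + (-1) \<cdot>\<^sub>v (B *\<^sub>v v)"
    using A B v by (auto simp: minus_mult_distrib_mat_vec)
  then have "l2_norm ((A - B) *\<^sub>v v) \<le> l2_norm (A *\<^sub>v v) + l2_norm (B *\<^sub>v v)"
    using A B v l2_norm_triangle[of "A *\<^sub>v v" m "(-1) \<cdot>\<^sub>v (B *\<^sub>v v)"] by simp
  also have "\<dots> \<le> op_norm A * l2_norm v + op_norm B * l2_norm v"
    using A B v by (intro add_mono l2_norm_mult_mat_vec_le) auto
  finally show "l2_norm ((A - B) *\<^sub>v v) \<le> (op_norm A + op_norm B) * l2_norm v"
    by (simp add: algebra_simps)
qed simp

text \<open>For w = A^T v one has |w|^2 = (A w) . v <= |A| |w| |v|, and |w| cancels unless it is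
  zero.\<close>

lemma op_norm_transpose_le:
  assumes A: "A \<in> carrier_mat m n"
  shows "op_norm (transpose_mat A) \<le> op_norm A"
proof (rule op_norm_le)
  show "transpose_mat A \<in> carrier_mat n m" using A by simp
  fix v :: "real vec" assume v: "v \<in> carrier_vec m"
  let ?w = "transpose_mat A *\<^sub>v v"
  have w: "?w \<in> carrier_vec n" using A v by auto
  have "(l2_norm ?w)\<^sup>2 = (A *\<^sub>v ?w) \<bullet> v"
    unfolding l2_norm_power2 using transpose_vec_mult_scalar[OF A w v]
    using A w v by (simp add: comm_scalar_prod[of "A *\<^sub>v ?w" m v])
  also have "\<dots> \<le> l2_norm (A *\<^sub>v ?w) * l2_norm v"
    using abs_scalar_prod_le[of "A *\<^sub>v ?w" m v] A v w by auto
  also have "\<dots> \<le> op_norm A * l2_norm ?w * l2_norm v"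
    using A w by (intro mult_right_mono l2_norm_mult_mat_vec_le) auto
  finally have *: "l2_norm ?w * l2_norm ?w \<le> (op_norm A * l2_norm v) * l2_norm ?w"
    by (simp add: power2_eq_square algebra_simps)
  show "l2_norm ?w \<le> op_norm A * l2_norm v"
  proof (cases "l2_norm ?w = 0")
    case False
    then have "0 < l2_norm ?w" by (simp add: less_le)
    then show ?thesis using * by simp
  qed simp
qed simp

lemma op_norm_transpose [simp]: "op_norm (transpose_mat A) = op_norm A"
  using op_norm_transpose_le[of A "dim_row A" "dim_col A"]
    op_norm_transpose_le[of "transpose_mat A" "dim_col A" "dim_row A"] by simp


section \<open>Matrices in singular value form\<close>

definition diag_of :: "nat \<Rightarrow> (nat \<Rightarrow> real) \<Rightarrow> real mat" where
  "diag_of n f = mat n n (\<lambda>(i, j). if i = j then f i else 0)"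

definition orth_mat :: "nat \<Rightarrow> real mat \<Rightarrow> bool" where
  "orth_mat n U \<longleftrightarrow> U \<in> carrier_mat n n \<and> transpose_mat U * U = 1\<^sub>m n"

text \<open>The diagonal \<open>f\<close> carries no sign or order condition, so the same form
  covers a matrix, its truncations, its partial inverse and, with \<open>U = V\<close>, the
  projectors.\<close>

definition svd_form :: "nat \<Rightarrow> real mat \<Rightarrow> (nat \<Rightarrow> real) \<Rightarrow> real mat \<Rightarrow> real mat" where
  "svd_form n U f V = U * diag_of n f * transpose_mat V"

lemma diag_of_carrier [simp]: "diag_of n f \<in> carrier_mat n n"
  by (simp add: diag_of_def)

lemma diag_of_mult_vec:
  assumes "v \<in> carrier_vec n"
  shows "diag_of n f *\<^sub>v v = vec n (\<lambda>i. f i * v $ i)"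
proof (rule eq_vecI)
  fix i assume i: "i < dim_vec (vec n (\<lambda>i. f i * v $ i))"
  have "(diag_of n f *\<^sub>v v) $ i = (\<Sum>j = 0..<n. (if i = j then f i else 0) * v $ j)"
    using i assms by (simp add: diag_of_def scalar_prod_def)
  also have "\<dots> = (\<Sum>j = 0..<n. if j = i then f i * v $ i else 0)"
    by (rule sum.cong) auto
  finally show "(diag_of n f *\<^sub>v v) $ i = vec n (\<lambda>i. f i * v $ i) $ i"
    using i by simp
qed (simp add: diag_of_def)

lemma diag_of_mult: "diag_of n f * diag_of n g = diag_of n (\<lambda>i. f i * g i)"
proof (rule eq_matI)
  fix i j assume "i < dim_row (diag_of n (\<lambda>i. f i * g i))" "j < dim_col (diag_of n (\<lambda>i. f i * g i))"
  then have ij: "i < n" "j < n" by (simp_all add: diag_of_def)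
  have "(diag_of n f * diag_of n g) $$ (i, j) =
      (\<Sum>l = 0..<n. (if i = l then f i else 0) * (if l = j then g l else 0))"
    using ij by (simp add: diag_of_def scalar_prod_def)
  also have "\<dots> = (\<Sum>l = 0..<n. if l = i then (if i = j then f i * g i else 0) else 0)"
    by (rule sum.cong) auto
  finally show "(diag_of n f * diag_of n g) $$ (i, j) = diag_of n (\<lambda>i. f i * g i) $$ (i, j)"
    using ij by (simp add: diag_of_def)
qed (simp_all add: diag_of_def)

lemma diag_of_transpose [simp]: "transpose_mat (diag_of n f) = diag_of n f"
  by (rule eq_matI) (auto simp: diag_of_def)

lemma orth_mat_carrier: "orth_mat n U \<Longrightarrow> U \<in> carrier_mat n n"
  by (simp add: orth_mat_def)

lemma orth_mat_mult_transpose: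
  assumes "orth_mat n U"
  shows "U * transpose_mat U = 1\<^sub>m n"
  using assms mat_mult_left_right_inverse[of "transpose_mat U" n U]
  by (simp add: orth_mat_def)

lemma orth_mat_transpose:
  "orth_mat n U \<Longrightarrow> orth_mat n (transpose_mat U)"
  using orth_mat_mult_transpose[of n U] by (simp add: orth_mat_def)

lemma orth_mat_transpose_mult_vec:
  assumes U: "orth_mat n U" and v: "v \<in> carrier_vec n"
  shows "transpose_mat U *\<^sub>v (U *\<^sub>v v) = v"
proof -
  have "transpose_mat U *\<^sub>v (U *\<^sub>v v) = transpose_mat U * U *\<^sub>v v"
    using U v by (intro assoc_mult_mat_vec[symmetric, of _ n n _ n]) (auto simp: orth_mat_def)
  then show ?thesis using U v by (simp add: orth_mat_def)
qed

lemma l2_norm_orth_mat: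
  assumes U: "orth_mat n U" and v: "v \<in> carrier_vec n"
  shows "l2_norm (U *\<^sub>v v) = l2_norm v"
proof -
  have "(U *\<^sub>v v) \<bullet> (U *\<^sub>v v) = (transpose_mat U *\<^sub>v (U *\<^sub>v v)) \<bullet> v"
    using transpose_vec_mult_scalar[of U n n v "U *\<^sub>v v"] U v
    by (simp add: orth_mat_def comm_scalar_prod[of v n])
  also have "transpose_mat U *\<^sub>v (U *\<^sub>v v) = v"
    by (rule orth_mat_transpose_mult_vec[OF U v])
  finally show ?thesis by (simp add: l2_norm_def)
qed

lemma svd_form_carrier [simp]:
  assumes "orth_mat n U" "orth_mat n V"
  shows "svd_form n U f V \<in> carrier_mat n n"
  using assms by (auto simp: svd_form_def orth_mat_def intro!: mult_carrier_mat)

lemma svd_form_cong: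
  assumes "\<And>i. i < n \<Longrightarrow> f i = g i"
  shows "svd_form n U f V = svd_form n U g V"
proof -
  have "diag_of n f = diag_of n g" using assms by (intro eq_matI) (auto simp: diag_of_def)
  then show ?thesis by (simp add: svd_form_def)
qed

text \<open>The inner factors cancel because \<open>V\<close> is orthogonal. This turns the later
  matrix identities into entrywise identities between diagonals.\<close>

lemma svd_form_mult:
  assumes U: "orth_mat n U" and V: "orth_mat n V" and W: "orth_mat n W"
  shows "svd_form n U f V * svd_form n V g W = svd_form n U (\<lambda>i. f i * g i) W"
proof -
  note c = orth_mat_carrier[OF U] orth_mat_carrier[OF V]
    orth_mat_carrier[OF W]
  have "svd_form n U f V * svd_form n V g W =
      U * (diag_of n f * ((transpose_mat V * V) * (diag_of n g * transpose_mat W)))"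
    using c by (simp add: svd_form_def assoc_mult_mat[of _ n n _ n _ n] mult_carrier_mat[of _ n n _ n])
  also have "(transpose_mat V * V) * (diag_of n g * transpose_mat W) = diag_of n g * transpose_mat W"
    using c V left_mult_one_mat[of "diag_of n g * transpose_mat W" n n]
    by (simp add: orth_mat_def mult_carrier_mat[of _ n n _ n])
  also have "U * (diag_of n f * (diag_of n g * transpose_mat W)) =
      U * (diag_of n f * diag_of n g) * transpose_mat W"
    using c by (simp add: assoc_mult_mat[of _ n n _ n _ n] mult_carrier_mat[of _ n n _ n])
  finally show ?thesis by (simp add: svd_form_def diag_of_mult)
qed

lemma svd_form_transpose:
  assumes U: "orth_mat n U" and V: "orth_mat n V"
  shows "transpose_mat (svd_form n U f V) = svd_form n V f U"
proof -
  note c = orth_mat_carrier[OF U] orth_mat_carrier[OF V]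
  show ?thesis using c
    by (simp add: svd_form_def transpose_mult[of _ n n _ n] mult_carrier_mat[of _ n n _ n]
        assoc_mult_mat[of _ n n _ n _ n])
qed

lemma svd_form_mult_vec:
  assumes "orth_mat n U" "orth_mat n V" "x \<in> carrier_vec n"
  shows "svd_form n U f V *\<^sub>v x = U *\<^sub>v (diag_of n f *\<^sub>v (transpose_mat V *\<^sub>v x))"
  using assms orth_mat_carrier[OF assms(1)] orth_mat_carrier[OF assms(2)]
  by (simp add: svd_form_def assoc_mult_mat_vec[of _ n n _ n] mult_carrier_mat[of _ n n _ n]
      mult_mat_vec_carrier[of _ n n])

lemma l2_norm_svd_form_mult_vec:
  assumes U: "orth_mat n U" and V: "orth_mat n V" and x: "x \<in> carrier_vec n"
  shows "l2_norm (svd_form n U f V *\<^sub>v x) = l2_norm (diag_of n f *\<^sub>v (transpose_mat V *\<^sub>v x))"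
  using l2_norm_orth_mat[OF U] x orth_mat_carrier[OF V]
  by (simp add: svd_form_mult_vec[OF U V x] mult_mat_vec_carrier[of _ n n])

text \<open>The comparison is coordinatewise, and coordinates where \<open>y\<close> vanishes
  contribute nothing. Asking for the bound only on the support of \<open>y\<close> is what Weyl's
  argument below relies on.\<close>

lemma l2_norm_diag_of_le:
  assumes y: "y \<in> carrier_vec n" and "0 \<le> c"
    and le: "\<And>i. i < n \<Longrightarrow> y $ i \<noteq> 0 \<Longrightarrow> \<bar>f i\<bar> \<le> c"
  shows "l2_norm (diag_of n f *\<^sub>v y) \<le> c * l2_norm y"
proof -
  have "\<bar>f i * y $ i\<bar> \<le> \<bar>c * y $ i\<bar>" if "i < n" for i
    using le[OF that] \<open>0 \<le> c\<close> by (cases "y $ i = 0") (auto simp: abs_mult intro: mult_right_mono)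
  then have "L2_set (\<lambda>i. f i * y $ i) {0..<n} \<le> L2_set (\<lambda>i. c * y $ i) {0..<n}"
    unfolding L2_set_def by (intro real_sqrt_le_mono sum_mono) (auto simp: abs_le_square_iff)
  also have "\<dots> = c * L2_set (\<lambda>i. y $ i) {0..<n}"
    using \<open>0 \<le> c\<close> by (simp add: L2_set_right_distrib)
  finally show ?thesis
    using y by (simp add: diag_of_mult_vec l2_norm_eq_L2_set L2_set_def)
qed

lemma l2_norm_diag_of_ge:
  assumes y: "y \<in> carrier_vec n" and "0 \<le> c"
    and ge: "\<And>i. i < n \<Longrightarrow> y $ i \<noteq> 0 \<Longrightarrow> c \<le> \<bar>f i\<bar>"
  shows "c * l2_norm y \<le> l2_norm (diag_of n f *\<^sub>v y)"
proof -
  have "\<bar>c * y $ i\<bar> \<le> \<bar>f i * y $ i\<bar>" if "i < n" for i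
    using ge[OF that] \<open>0 \<le> c\<close> by (cases "y $ i = 0") (auto simp: abs_mult intro: mult_right_mono)
  then have "L2_set (\<lambda>i. c * y $ i) {0..<n} \<le> L2_set (\<lambda>i. f i * y $ i) {0..<n}"
    unfolding L2_set_def by (intro real_sqrt_le_mono sum_mono) (auto simp: abs_le_square_iff)
  moreover have "L2_set (\<lambda>i. c * y $ i) {0..<n} = c * L2_set (\<lambda>i. y $ i) {0..<n}"
    using \<open>0 \<le> c\<close> by (simp add: L2_set_right_distrib)
  moreover have "l2_norm (diag_of n f *\<^sub>v y) = L2_set (\<lambda>i. f i * y $ i) {0..<n}"
    using y by (simp add: diag_of_mult_vec l2_norm_eq_L2_set L2_set_def)
  ultimately show ?thesis
    using y by (simp add: l2_norm_eq_L2_set)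
qed

lemma op_norm_svd_form_le:
  assumes U: "orth_mat n U" and V: "orth_mat n V" and c: "0 \<le> c"
    and le: "\<And>i. i < n \<Longrightarrow> \<bar>f i\<bar> \<le> c"
  shows "op_norm (svd_form n U f V) \<le> c"
proof (rule op_norm_le[of _ n n])
  fix x :: "real vec" assume x: "x \<in> carrier_vec n"
  have y: "transpose_mat V *\<^sub>v x \<in> carrier_vec n"
    using x orth_mat_carrier[OF V] by (simp add: mult_mat_vec_carrier[of _ n n])
  show "l2_norm (svd_form n U f V *\<^sub>v x) \<le> c * l2_norm x"
    using l2_norm_diag_of_le[OF y c le] l2_norm_orth_mat[OF orth_mat_transpose[OF V] x]
    by (simp add: l2_norm_svd_form_mult_vec[OF U V x])
qed (use c svd_form_carrier[OF U V] in simp_all)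

text \<open>Weyl's inequality in the manner of Courant and Fischer: by a dimension count, some
  nonzero combination of the first \<open>i + 1\<close> columns of \<open>V'\<close> is orthogonal
  to the first \<open>i\<close> columns of \<open>V\<close>. The matrix with diagonal
  \<open>t\<close> stretches it by at least \<open>\<tau>\<close>, the one with diagonal
  \<open>s\<close> by at most \<open>\<sigma>\<close>, and the triangle inequality compares the two.
  Indices start at 0.\<close>

lemma singular_value_perturbation:
  assumes U: "orth_mat n U" and V: "orth_mat n V"
    and U': "orth_mat n U'" and V': "orth_mat n V'"
    and s: "\<And>j. i \<le> j \<Longrightarrow> j < n \<Longrightarrow> \<bar>s j\<bar> \<le> \<sigma>"
    and t: "\<And>j. j \<le> i \<Longrightarrow> \<tau> \<le> \<bar>t j\<bar>"
    and i: "i < n" and nonneg: "0 \<le> \<sigma>" "0 \<le> \<tau>"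
  shows "\<tau> \<le> \<sigma> + op_norm (svd_form n U' t V' - svd_form n U s V)"
proof -
  let ?A = "svd_form n U s V" and ?B = "svd_form n U' t V'"
  let ?G = "transpose_mat V * V'"
  have c: "V \<in> carrier_mat n n" "V' \<in> carrier_mat n n"
    using V V' by (simp_all add: orth_mat_carrier)
  have G: "?G \<in> carrier_mat n n" using c by (simp add: mult_carrier_mat[of _ n n])
  let ?r = "\<lambda>p. if p = i then 0\<^sub>v n else (if p < i then row ?G p else unit_vec n p)"
  let ?Z = "mat\<^sub>r n n ?r"
  \<comment> \<open>a kernel vector of \<open>?Z\<close> is a combination of the first \<open>i + 1\<close> columns of \<open>V'\<close> orthogonal to the
    first \<open>i\<close> columns of \<open>V\<close>\<close>
  have "det ?Z = 0"
    by (rule det_row_0[OF i]) (use c in auto)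
  then obtain y where y: "y \<in> carrier_vec n" "y \<noteq> 0\<^sub>v n" "?Z *\<^sub>v y = 0\<^sub>v n"
    using det_0_iff_vec_prod_zero_field[of ?Z n] by auto
  have Zy: "?r p \<bullet> y = 0" if "p < n" for p
  proof -
    have "(?Z *\<^sub>v y) $ p = 0" using y(3) that by simp
    moreover have "row ?Z p = ?r p" using that c by (intro row_mat_of_row_fun) auto
    ultimately show ?thesis using that by simp
  qed
  have y0: "y $ p = 0" if "i < p" "p < n" for p
    using Zy[OF that(2)] that y(1) by simp
  have Gy0: "(?G *\<^sub>v y) $ p = 0" if "p < i" for p
    using Zy[of p] that i c by simp
  \<comment> \<open>In the columns of \<open>V'\<close> this vector has coordinates
    \<open>y\<close>, supported on indices up to \<open>i\<close>; in the columns of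
    \<open>V\<close> it has coordinates \<open>?G *\<^sub>v y\<close>, supported on indices from
    \<open>i\<close> on.\<close>
  let ?x = "V' *\<^sub>v y"
  have x: "?x \<in> carrier_vec n" using c y by (simp add: mult_mat_vec_carrier[of _ n n])
  have nx: "l2_norm ?x = l2_norm y" by (rule l2_norm_orth_mat[OF V' y(1)])
  have V'x: "transpose_mat V' *\<^sub>v ?x = y"
    by (rule orth_mat_transpose_mult_vec[OF V' y(1)])
  have Vx: "transpose_mat V *\<^sub>v ?x = ?G *\<^sub>v y"
    using assoc_mult_mat_vec[of "transpose_mat V" n n V' n y] c y(1) by simp
  have Gy: "?G *\<^sub>v y \<in> carrier_vec n" using G y by (simp add: mult_mat_vec_carrier[of _ n n])
  have nGy: "l2_norm (?G *\<^sub>v y) = l2_norm y"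
    using l2_norm_orth_mat[OF orth_mat_transpose[OF V] x] nx Vx by simp
  have B: "\<tau> * l2_norm y \<le> l2_norm (?B *\<^sub>v ?x)"
    unfolding l2_norm_svd_form_mult_vec[OF U' V' x] V'x
    by (rule l2_norm_diag_of_ge[OF y(1) nonneg(2)]) (metis t y0 not_le)
  have A: "l2_norm (?A *\<^sub>v ?x) \<le> \<sigma> * l2_norm y"
    using l2_norm_diag_of_le[OF Gy nonneg(1), of s] Gy0 s
    unfolding l2_norm_svd_form_mult_vec[OF U V x] Vx nGy by (metis not_le)
  have cA: "?A \<in> carrier_mat n n" "?B \<in> carrier_mat n n" using U V U' V' by simp_all
  have cv: "?A *\<^sub>v ?x \<in> carrier_vec n" "?B *\<^sub>v ?x \<in> carrier_vec n"
    using cA x by (simp_all add: mult_mat_vec_carrier[of _ n n])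
  have "?B *\<^sub>v ?x = ?A *\<^sub>v ?x + (?B *\<^sub>v ?x - ?A *\<^sub>v ?x)"
    using cv cA by (intro eq_vecI) auto
  also have "?B *\<^sub>v ?x - ?A *\<^sub>v ?x = (?B - ?A) *\<^sub>v ?x"
    by (rule minus_mult_distrib_mat_vec[OF cA(2,1) x, symmetric])
  finally have eq: "?B *\<^sub>v ?x = ?A *\<^sub>v ?x + (?B - ?A) *\<^sub>v ?x" .
  have "(?B - ?A) *\<^sub>v ?x \<in> carrier_vec n"
    by (rule mult_mat_vec_carrier[OF minus_carrier_mat[OF cA(1)] x])
  then have "l2_norm (?B *\<^sub>v ?x) \<le> l2_norm (?A *\<^sub>v ?x) + l2_norm ((?B - ?A) *\<^sub>v ?x)"
    unfolding eq by (rule l2_norm_triangle[OF cv(1)])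
  also have "l2_norm ((?B - ?A) *\<^sub>v ?x) \<le> op_norm (?B - ?A) * l2_norm y"
    using l2_norm_mult_mat_vec_le[OF minus_carrier_mat[OF cA(1)] x, of ?B] nx by simp
  finally have "\<tau> * l2_norm y \<le> (\<sigma> + op_norm (?B - ?A)) * l2_norm y"
    using A B by (simp add: algebra_simps)
  moreover have "0 < l2_norm y"
    using l2_norm_eq_0_iff[OF y(1)] y(2) by (simp add: less_le)
  ultimately show ?thesis by simp
qed


section \<open>Perturbation of singular subspaces\<close>

text \<open>Used as a diagonal: for orthogonal \<open>U\<close>,
  \<open>svd_form n U (below k) U\<close> projects onto the span of the first \<open>k\<close>
  columns of \<open>U\<close>, and \<open>from_on k\<close> in its place gives the complementary
  projector.\<close>

abbreviation below :: "nat \<Rightarrow> nat \<Rightarrow> real" where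
  "below k \<equiv> \<lambda>i. if i < k then 1 else 0"

abbreviation from_on :: "nat \<Rightarrow> nat \<Rightarrow> real" where
  "from_on k \<equiv> \<lambda>i. if i < k then 0 else 1"

section \<open>Sine theorem of Wedin type for products of complementary projectors\<close>

lemma op_norm_cross_projection_le_1:
  assumes "orth_mat n U" "orth_mat n U'"
  shows "op_norm (svd_form n U' (from_on k) U' * svd_form n U (below k) U) \<le> 1"
proof -
  have "op_norm (svd_form n U' (from_on k) U') \<le> 1" "op_norm (svd_form n U (below k) U) \<le> 1"
    using assms by (auto intro!: op_norm_svd_form_le)
  then have "op_norm (svd_form n U' (from_on k) U') * op_norm (svd_form n U (below k) U) \<le> 1 * 1"
    by (intro mult_mono) auto
  then show ?thesis
    using op_norm_mult_le[of "svd_form n U' (from_on k) U'" n n "svd_form n U (below k) U" n] assms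
    by simp
qed

text \<open>Expand \<open>C * ((B - A) * I)\<close>, replace \<open>A * I\<close> by
  \<open>P\<close>, and insert \<open>Q\<close> and \<open>D\<close> into \<open>C * (B * I)\<close>
  through \<open>Q * I = I\<close> and \<open>T * D = C * B\<close>. Here \<open>I\<close> is not
  the identity; it will be a partial inverse of \<open>A\<close>.\<close>

lemma wedin_identity:
  assumes A: "A \<in> carrier_mat n n" and B: "B \<in> carrier_mat n n" and I: "I \<in> carrier_mat n n"
    and C: "C \<in> carrier_mat n n" and D: "D \<in> carrier_mat n n"
    and Q: "Q \<in> carrier_mat n n" and T: "T \<in> carrier_mat n n"
    and AI: "A * I = P" and QI: "Q * I = I" and TD: "T * D = C * B"
  shows "C * P = T * (D * Q) * I - C * ((B - A) * I :: 'a::ring_1 mat)"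
proof -
  note mc = mult_carrier_mat[of _ n n _ n]
  have P: "P \<in> carrier_mat n n" using mc[OF A I] AI by simp
  have "C * ((B - A) * I) = C * (B * I) - C * P"
    unfolding minus_mult_distrib_mat[OF B A I] AI mult_minus_distrib_mat[OF C mc[OF B I] P] ..
  moreover have "T * (D * Q) * I = C * (B * I)"
  proof -
    have "T * (D * Q) * I = T * (D * (Q * I))"
      unfolding assoc_mult_mat[OF T mc[OF D Q] I] assoc_mult_mat[OF D Q I] ..
    also have "\<dots> = T * D * I" unfolding QI assoc_mult_mat[OF T D I] ..
    finally show ?thesis unfolding TD assoc_mult_mat[OF C B I] .
  qed
  ultimately show ?thesis
    using mc[OF C mc[OF B I]] mc[OF C P] by (auto intro!: eq_matI)
qed

text \<open>Norms are taken in the algebraic identity: the partial inverse has norm at most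
  \<open>1 / a\<close>, the truncated perturbed matrix at most \<open>b\<close>, the projector at
  most 1. Left singular vectors are thereby controlled through right ones, so the bound is to be
  combined with its transposed version.\<close>

lemma wedin_step:
  assumes U: "orth_mat n U" and V: "orth_mat n V"
    and U': "orth_mat n U'" and V': "orth_mat n V'"
    and s: "\<And>i. i < k \<Longrightarrow> i < n \<Longrightarrow> a \<le> s i"
    and t: "\<And>i. k \<le> i \<Longrightarrow> i < n \<Longrightarrow> \<bar>t i\<bar> \<le> b"
    and a: "0 < a" and b: "0 \<le> b"
  shows "a * op_norm (svd_form n U' (from_on k) U' * svd_form n U (below k) U) \<le>
    b * op_norm (svd_form n V' (from_on k) V' * svd_form n V (below k) V) +
    op_norm (svd_form n U' t V' - svd_form n U s V)"
proof -
  let ?A = "svd_form n U s V" and ?B = "svd_form n U' t V'"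
  let ?P = "svd_form n U (below k) U" and ?Q = "svd_form n V (below k) V"
  let ?C = "svd_form n U' (from_on k) U'" and ?D = "svd_form n V' (from_on k) V'"
  \<comment> \<open>\<open>?T\<close> is \<open>?B\<close> cut down to indices from \<open>k\<close>
    on, and \<open>?I\<close> inverts \<open>?A\<close> on the range of \<open>?P\<close>. From
    \<open>k\<close> on the diagonal of \<open>?I\<close> is \<open>0 / s i = 0\<close>, also where
    \<open>s i = 0\<close>.\<close>
  let ?T = "svd_form n U' (\<lambda>i. from_on k i * t i) V'"
  let ?I = "svd_form n V (\<lambda>i. below k i / s i) U"
  let ?E = "?B - ?A"
  note mc = mult_carrier_mat[of _ n n _ n]
  note sc = svd_form_carrier[OF U V] svd_form_carrier[OF U' V'] svd_form_carrier[OF V U]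
    svd_form_carrier[OF U U] svd_form_carrier[OF V V]
    svd_form_carrier[OF U' U'] svd_form_carrier[OF V' V']
  have E: "?E \<in> carrier_mat n n" by (rule minus_carrier_mat[OF sc(1)])
  have Tb: "op_norm ?T \<le> b"
    using t b by (intro op_norm_svd_form_le[OF U' V']) auto
  have Cb: "op_norm ?C \<le> 1"
    by (intro op_norm_svd_form_le[OF U' U']) auto
  have Ia: "op_norm ?I \<le> 1 / a"
  proof (rule op_norm_svd_form_le[OF V U])
    fix i assume "i < n"
    then have "i < k \<Longrightarrow> 1 / s i \<le> 1 / a \<and> 0 < s i"
      using s[of i] a by (auto intro: divide_left_mono)
    then show "\<bar>below k i / s i\<bar> \<le> 1 / a" using a by auto
  qed (use a in simp)
  have AI: "?A * ?I = ?P"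
    unfolding svd_form_mult[OF U V U]
  proof (rule svd_form_cong)
    fix i assume "i < n"
    then show "s i * (below k i / s i) = below k i" using s[of i] a by auto
  qed
  have QI: "?Q * ?I = ?I"
    unfolding svd_form_mult[OF V V U] by (rule svd_form_cong) simp
  have TD: "?T * ?D = ?C * ?B"
    unfolding svd_form_mult[OF U' V' V'] svd_form_mult[OF U' U' V'] by (rule svd_form_cong) simp
  have "?C * ?P = ?T * (?D * ?Q) * ?I - ?C * ((?B - ?A) * ?I)"
    by (rule wedin_identity[OF sc(1,2,3,6,7,5,2) AI QI TD])
  then have "op_norm (?C * ?P) \<le> op_norm (?T * (?D * ?Q) * ?I) + op_norm (?C * (?E * ?I))"
    using op_norm_diff_le[OF mc[OF mc[OF sc(2) mc[OF sc(7,5)]] sc(3)] mc[OF sc(6) mc[OF E sc(3)]]]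
    by simp
  also have "op_norm (?T * (?D * ?Q) * ?I) \<le> b * op_norm (?D * ?Q) * (1 / a)"
  proof -
    have "op_norm (?T * (?D * ?Q) * ?I) \<le> op_norm (?T * (?D * ?Q)) * op_norm ?I"
      by (rule op_norm_mult_le[OF mc[OF sc(2) mc[OF sc(7,5)]] sc(3)])
    also have "\<dots> \<le> (b * op_norm (?D * ?Q)) * (1 / a)"
    proof (rule mult_mono)
      show "op_norm (?T * (?D * ?Q)) \<le> b * op_norm (?D * ?Q)"
        by (rule order_trans[OF op_norm_mult_le[OF sc(2) mc[OF sc(7,5)]]])
           (intro mult_right_mono Tb op_norm_nonneg)
    qed (use Ia b in simp_all)
    finally show ?thesis .
  qed
  also have "op_norm (?C * (?E * ?I)) \<le> op_norm ?E * (1 / a)"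
  proof -
    have "op_norm (?C * (?E * ?I)) \<le> op_norm ?C * op_norm (?E * ?I)"
      by (rule op_norm_mult_le[OF sc(6) mc[OF E sc(3)]])
    also have "\<dots> \<le> 1 * op_norm (?E * ?I)"
      by (intro mult_right_mono Cb op_norm_nonneg)
    also have "op_norm (?E * ?I) \<le> op_norm ?E * op_norm ?I"
      by (rule op_norm_mult_le[OF E sc(3)])
    also have "\<dots> \<le> op_norm ?E * (1 / a)"
      by (intro mult_left_mono Ia op_norm_nonneg)
    finally show ?thesis by simp
  qed
  finally show ?thesis using a by (simp add: field_simps)
qed

text \<open>The one-sided bound and its transpose form a coupled pair for the left and right cross
  projections. The larger of the two norms, m, satisfies a m <= b m + e, hence (a - b) m <=
  e.\<close>

lemma sin_theta:
  assumes U: "orth_mat n U" and V: "orth_mat n V"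
    and U': "orth_mat n U'" and V': "orth_mat n V'"
    and s: "\<And>i. i < k \<Longrightarrow> i < n \<Longrightarrow> a \<le> s i"
    and t: "\<And>i. k \<le> i \<Longrightarrow> i < n \<Longrightarrow> \<bar>t i\<bar> \<le> b"
    and b: "0 \<le> b"
  shows "(a - b) * op_norm (svd_form n U' (from_on k) U' * svd_form n U (below k) U) \<le>
    op_norm (svd_form n U' t V' - svd_form n U s V)" (is "(a - b) * ?X \<le> ?e")
proof (cases "a \<le> b")
  \<comment> \<open>The left side is then nonpositive, so later uses need not check that the gap
    survives the perturbation.\<close>
  case True
  then have "(a - b) * ?X \<le> 0" by (simp add: mult_nonpos_nonneg)
  then show ?thesis using op_norm_nonneg order_trans by blast
next
  case False
  then have a: "0 < a" using b by simp
  let ?Y = "op_norm (svd_form n V' (from_on k) V' * svd_form n V (below k) V)"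
  \<comment> \<open>Transposition exchanges left and right singular vectors and leaves the norm of
    the difference unchanged.\<close>
  have "svd_form n V' t U' - svd_form n V s U = transpose_mat (svd_form n U' t V' - svd_form n U s V)"
    using svd_form_carrier[OF U V] svd_form_carrier[OF U' V']
    by (simp add: transpose_minus[of _ n n] svd_form_transpose[OF U V] svd_form_transpose[OF U' V'])
  then have "a * ?Y \<le> b * ?X + ?e"
    using wedin_step[OF V U V' U', of k a s t b] s t a b by simp
  moreover have "a * ?X \<le> b * ?Y + ?e"
    using wedin_step[OF U V U' V', of k a s t b] s t a b by simp
  moreover have "b * ?X \<le> b * max ?X ?Y" "b * ?Y \<le> b * max ?X ?Y"
    using b by (intro mult_left_mono; simp)+
  ultimately have "a * max ?X ?Y \<le> b * max ?X ?Y + ?e"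
    by (smt (verit) max_def)
  then have "(a - b) * max ?X ?Y \<le> ?e"
    by (simp add: left_diff_distrib)
  moreover have "(a - b) * ?X \<le> (a - b) * max ?X ?Y"
    using False by (intro mult_left_mono) auto
  ultimately show ?thesis by simp
qed

text \<open>P' - P = P' (1 - P) - (1 - P') P, and the first term is the transpose of (1 - P) P'.
  Adding the two cross terms contributes a factor two to the final constant.\<close>

lemma projector_diff_le:
  assumes U: "orth_mat n U" and U': "orth_mat n U'"
  shows "op_norm (svd_form n U' (below k) U' - svd_form n U (below k) U) \<le>
    op_norm (svd_form n U' (from_on k) U' * svd_form n U (below k) U) +
    op_norm (svd_form n U (from_on k) U * svd_form n U' (below k) U')"
proof -
  let ?P = "svd_form n U (below k) U" and ?P' = "svd_form n U' (below k) U'"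
  have compl: "svd_form n W (from_on k) W = 1\<^sub>m n - svd_form n W (below k) W"
    if W: "orth_mat n W" for W
  proof -
    have "diag_of n (from_on k) = 1\<^sub>m n - diag_of n (below k)"
      by (rule eq_matI) (auto simp: diag_of_def)
    then have "svd_form n W (from_on k) W =
        (W * 1\<^sub>m n - W * diag_of n (below k)) * transpose_mat W"
      using orth_mat_carrier[OF W]
      by (simp add: svd_form_def mult_minus_distrib_mat[of W n n "1\<^sub>m n" n "diag_of n (below k)"])
    also have "\<dots> = W * 1\<^sub>m n * transpose_mat W - svd_form n W (below k) W"
      unfolding svd_form_def using orth_mat_carrier[OF W]
      by (intro minus_mult_distrib_mat[of _ n n _ _ n]) (auto intro!: mult_carrier_mat[of _ n n _ n])
    finally show ?thesis
      using orth_mat_mult_transpose[OF W] orth_mat_carrier[OF W] by simp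
  qed
  note mc = mult_carrier_mat[of _ n n _ n]
  have P: "?P \<in> carrier_mat n n" "?P' \<in> carrier_mat n n" using U U' by simp_all
  let ?X = "(1\<^sub>m n - ?P') * ?P" and ?Y = "(1\<^sub>m n - ?P) * ?P'"
  have XY: "?X \<in> carrier_mat n n" "?Y \<in> carrier_mat n n" using P by (auto intro!: mc)
  have X: "?X = ?P - ?P' * ?P"
    using P by (simp add: minus_mult_distrib_mat[OF one_carrier_mat P(2) P(1)])
  have "transpose_mat ?Y = transpose_mat ?P' * transpose_mat (1\<^sub>m n - ?P)"
    by (rule transpose_mult[OF minus_carrier_mat[OF P(1)] P(2)])
  also have "\<dots> = ?P' * (1\<^sub>m n - ?P)"
    by (simp add: transpose_minus[OF one_carrier_mat P(1)] svd_form_transpose U U')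
  also have "\<dots> = ?P' - ?P' * ?P"
    using P by (simp add: mult_minus_distrib_mat[OF P(2) one_carrier_mat P(1)])
  finally have "?P' - ?P = transpose_mat ?Y - ?X"
    using X P mc[OF P(2,1)] by (auto intro!: eq_matI)
  then have "op_norm (?P' - ?P) \<le> op_norm (transpose_mat ?Y) + op_norm ?X"
    using op_norm_diff_le[of "transpose_mat ?Y" n n ?X] XY by simp
  then show ?thesis by (simp add: compl[OF U] compl[OF U'])
qed

section \<open>From the definitions of singular values and projectors to explicit
  decompositions\<close>

lemma is_svd_iff_svd_form:
  assumes "A \<in> carrier_mat n n"
  shows "is_svd A U s V \<longleftrightarrow> orth_mat n U \<and> orth_mat n V \<and> (\<forall>i<n. 0 \<le> s i) \<and>
    (\<forall>i j. i \<le> j \<longrightarrow> j < n \<longrightarrow> s j \<le> s i) \<and> A = svd_form n U s V"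
  using assms by (auto simp: is_svd_def orth_mat_def svd_form_def diag_of_def Let_def)

lemma is_svd_transpose:
  assumes A: "A \<in> carrier_mat n n" and "is_svd A U s V"
  shows "is_svd (transpose_mat A) V s U"
  using assms by (auto simp: is_svd_iff_svd_form[of _ n] svd_form_transpose)

lemma sorted_mset_eq:
  fixes xs ys :: "'a::linorder list"
  assumes "sorted_wrt (\<ge>) xs" "sorted_wrt (\<ge>) ys" "mset xs = mset ys"
  shows "xs = ys"
proof -
  have "sorted (rev xs)" "sorted (rev ys)" using assms by (simp_all add: sorted_wrt_rev)
  then have "rev xs = rev ys" using assms(3)
    by (metis mset_rev properties_for_sort)
  then show ?thesis by simp
qed

text \<open>Recovers a list, up to order, from the polynomial having its entries as roots; this
  gives the uniqueness that \<open>singular_values\<close> requires.\<close>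

lemma proots_prod_linear: "proots (\<Prod>x\<leftarrow>xs. [:- f x, 1 :: real:]) = mset (map f xs)"
proof (induction xs)
  case (Cons x xs)
  have "(\<Prod>x\<leftarrow>xs. [:- f x, 1 :: real:]) \<noteq> 0" by (auto simp: prod_list_zero_iff)
  then show ?case using Cons by (simp add: proots_mult del: mult_pCons_left)
qed simp

text \<open>A^T A is orthogonally similar to the diagonal matrix of the squares of the
  \<open>s i\<close>, which gives its characteristic polynomial. Conversely, that polynomial fixes
  the multiset of squares, nonnegativity fixes the values, and sortedness fixes the list.\<close>

lemma singular_values_svd:
  assumes A: "A \<in> carrier_mat n n" and svd: "is_svd A U s V"
  shows "singular_values A = map s [0..<n]"
  unfolding singular_values_def
proof (rule the_equality)
  have U: "orth_mat n U" and V: "orth_mat n V" and s0: "\<And>i. i < n \<Longrightarrow> 0 \<le> s i"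
    and s: "\<And>i j. i \<le> j \<Longrightarrow> j < n \<Longrightarrow> s j \<le> s i" and eq: "A = svd_form n U s V"
    using svd by (auto simp: is_svd_iff_svd_form[OF A])
  have "transpose_mat A * A = svd_form n V (\<lambda>i. (s i)\<^sup>2) V"
    unfolding eq svd_form_transpose[OF U V] svd_form_mult[OF V U V] by (simp add: power2_eq_square)
  also have "char_poly \<dots> = char_poly (diag_of n (\<lambda>i. (s i)\<^sup>2))"
    using V orth_mat_mult_transpose[OF V]
    by (intro char_poly_similar similar_matI[of _ _ V "transpose_mat V" n])
       (auto simp: svd_form_def orth_mat_def intro!: mult_carrier_mat[of _ n n])
  also have "\<dots> = (\<Prod>a\<leftarrow>diag_mat (diag_of n (\<lambda>i. (s i)\<^sup>2)). [:- a, 1:])"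
    by (rule char_poly_upper_triangular[of _ n]) (auto simp: diag_of_def)
  also have "diag_mat (diag_of n (\<lambda>i. (s i)\<^sup>2)) = map (\<lambda>i. (s i)\<^sup>2) [0..<n]"
    by (auto simp: diag_mat_def diag_of_def)
  finally have cp: "char_poly (transpose_mat A * A) = (\<Prod>x\<leftarrow>map s [0..<n]. [:- (x\<^sup>2), 1:])"
    by (simp add: comp_def)
  have so: "sorted_wrt (\<ge>) (map s [0..<n])"
    using s by (auto simp: sorted_wrt_iff_nth_less)
  have nn: "\<forall>x\<in>set (map s [0..<n]). 0 \<le> x" using s0 by auto
  show "sorted_wrt (\<ge>) (map s [0..<n]) \<and> (\<forall>x\<in>set (map s [0..<n]). 0 \<le> x) \<and>
    char_poly (transpose_mat A * A) = (\<Prod>x\<leftarrow>map s [0..<n]. [:- (x\<^sup>2), 1:])"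
    using so nn cp by blast
  fix xs
  assume xs: "sorted_wrt (\<ge>) xs \<and> (\<forall>x\<in>set xs. 0 \<le> x) \<and>
     char_poly (transpose_mat A * A) = (\<Prod>x\<leftarrow>xs. [:- (x\<^sup>2), 1:])"
  then have "mset (map power2 xs) = mset (map power2 (map s [0..<n]))"
    unfolding proots_prod_linear[symmetric] cp[symmetric] by simp
  then have "mset (map sqrt (map power2 xs)) = mset (map sqrt (map power2 (map s [0..<n])))"
    by (metis mset_map)
  moreover have "map sqrt (map power2 ys) = ys" if "\<forall>y\<in>set ys. 0 \<le> y" for ys :: "real list"
    using that by (induction ys) auto
  ultimately have "mset xs = mset (map s [0..<n])" using xs nn by metis
  then show "xs = map s [0..<n]" using xs so by (intro sorted_mset_eq) auto
qed

text \<open>\<open>sing_val\<close> counts from 1 and \<open>s\<close> from 0. The value 0 beyond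
  the dimension is the one met at index \<open>k + 1\<close> when \<open>k = n\<close>.\<close>

lemma sing_val_svd:
  assumes "A \<in> carrier_mat n n" "is_svd A U s V" "1 \<le> i"
  shows "sing_val A i = (if i \<le> n then s (i - 1) else 0)"
  using assms by (auto simp: sing_val_def singular_values_svd)

lemma col_mult_diag_of:
  assumes U: "U \<in> carrier_mat n n" and j: "j < n"
  shows "col (U * diag_of n f) j = f j \<cdot>\<^sub>v col U j"
proof (rule eq_vecI)
  fix i assume "i < dim_vec (f j \<cdot>\<^sub>v col U j)"
  then have i: "i < n" using U by simp
  have "col (U * diag_of n f) j $ i = (\<Sum>l = 0..<n. U $$ (i, l) * (if l = j then f l else 0))"
    using i j U by (simp add: diag_of_def scalar_prod_def)
  also have "\<dots> = (\<Sum>l = 0..<n. if l = j then f j * U $$ (i, j) else 0)"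
    by (rule sum.cong) auto
  finally show "col (U * diag_of n f) j $ i = (f j \<cdot>\<^sub>v col U j) $ i"
    using i j U by simp
qed (use U in simp)

text \<open>An orthogonal projector is determined by its range. This is checked on the orthonormal
  basis of columns of \<open>U\<close>: the first \<open>k\<close> are fixed and the others
  annihilated, so \<open>P * U\<close> is known and \<open>U\<close> can be cancelled.\<close>

lemma orth_projector_eq_svd_form:
  assumes U: "orth_mat n U" and k: "k \<le> n"
    and proj: "is_orth_projector n (vec_span n (set (take k (cols U)))) P"
  shows "P = svd_form n U (below k) U"
proof -
  interpret vec_space "TYPE(real)" n .
  let ?W = "set (take k (cols U))"
  have cU: "U \<in> carrier_mat n n" by (rule orth_mat_carrier[OF U])
  have P: "P \<in> carrier_mat n n" "P * P = P" "transpose_mat P = P"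
    "(\<lambda>x. P *\<^sub>v x) ` carrier_vec n = span ?W"
    using proj by (auto simp: is_orth_projector_def)
  have W: "?W = {col U i | i. i < k}"
    using cU k by (auto simp: cols_def take_map)
  have WC: "?W \<subseteq> carrier_vec n" using cU k by (auto simp: W)
  have fixed: "P *\<^sub>v u = u" if u: "u \<in> span ?W" for u
  proof -
    obtain x where "x \<in> carrier_vec n" "u = P *\<^sub>v x" using u unfolding P(4)[symmetric] by blast
    then show ?thesis using P assoc_mult_mat_vec[of P n n P n x] by simp
  qed
  have ortho: "col U j \<bullet> col U i = (if i = j then 1 else 0)" if "i < n" "j < n" for i j
  proof -
    have "(transpose_mat U * U) $$ (j, i) = 1\<^sub>m n $$ (j, i)" using U by (simp add: orth_mat_def)
    then show ?thesis using that cU by (auto split: if_splits)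
  qed
  have PU: "P *\<^sub>v col U j = (if j < k then col U j else 0\<^sub>v n)" if j: "j < n" for j
  proof (cases "j < k")
    case True
    then have "col U j \<in> span ?W" using in_own_span[OF WC] W by auto
    then show ?thesis using fixed True by simp
  next
    case False
    let ?w = "P *\<^sub>v col U j"
    have cj: "col U j \<in> carrier_vec n" using cU j by auto
    then have w: "?w \<in> span ?W" "?w \<in> carrier_vec n"
      using P by (auto simp: mult_mat_vec_carrier[of _ n n])
    \<comment> \<open>Symmetry moves \<open>P\<close> onto \<open>u\<close>, which it fixes, and
      distinct columns of \<open>U\<close> are orthogonal. Thus \<open>?w\<close> is orthogonal to a
      range that contains it and must vanish.\<close>
    have "?w \<bullet> u = 0" if "u \<in> ?W" for u
    proof -
      obtain i where i: "i < k" "u = col U i" using \<open>u \<in> ?W\<close> unfolding W by blast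
      have u: "u \<in> carrier_vec n" using WC that by auto
      have "?w \<bullet> u = (transpose_mat P *\<^sub>v u) \<bullet> col U j"
        using transpose_vec_mult_scalar[OF P(1) cj u] w(2) u by (simp add: comm_scalar_prod[of _ n])
      also have "\<dots> = u \<bullet> col U j"
        using fixed in_own_span[OF WC] that P(3) by auto
      finally show ?thesis using ortho[of j i] i False j k by auto
    qed
    then have "?w \<in> orthogonal_complement ?W"
      using w by (auto simp: orthogonal_complement_def)
    then have "?w \<in> orthogonal_complement (span ?W)"
      using in_orthogonal_complement_span[OF WC] by simp
    then have "?w \<bullet> ?w = 0" using w(1) by (auto simp: orthogonal_complement_def)
    then have "?w = 0\<^sub>v n" using l2_norm_eq_0_iff[OF w(2)] by (simp add: l2_norm_def)
    then show ?thesis using False by simp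
  qed
  have "P * U = U * diag_of n (below k)"
  proof (rule mat_col_eqI)
    fix j assume "j < dim_col (U * diag_of n (below k))"
    then have j: "j < n" by (simp add: diag_of_def)
    have "col (U * diag_of n (below k)) j = below k j \<cdot>\<^sub>v col U j"
      by (rule col_mult_diag_of[OF cU j])
    also have "\<dots> = P *\<^sub>v col U j"
      unfolding PU[OF j] using cU j by (intro eq_vecI) auto
    also have "\<dots> = col (P * U) j"
      using col_mult2[OF P(1) cU j] by simp
    finally show "col (P * U) j = col (U * diag_of n (below k)) j" ..
  qed (use P cU in \<open>auto simp: diag_of_def\<close>)
  moreover have "P * U * transpose_mat U = P * (U * transpose_mat U)"
    using P cU by (intro assoc_mult_mat[of _ n n _ n _ n]) auto
  ultimately have "P * (U * transpose_mat U) = svd_form n U (below k) U"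
    by (simp add: svd_form_def)
  then show ?thesis using P orth_mat_mult_transpose[OF U] by simp
qed

text \<open>The sine theorem is used in both directions, and Weyl's inequality lowers the gap by e
  each time: from A to B it raises the lower level to \<tau> + e, from B to A it reduces the upper
  level to \<sigma> - e. The product form also makes sense for a zero gap.\<close>

lemma top_left_projector_perturbation:
  assumes A: "A \<in> carrier_mat n n" and B: "B \<in> carrier_mat n n" and k: "1 \<le> k" "k \<le> n"
    and PA: "top_left_projector k A P" and PB: "top_left_projector k B P'"
  shows "(sing_val A k - sing_val A (k + 1)) * op_norm (P' - P) \<le> 4 * op_norm (B - A)"
proof -
  obtain U s V where svd: "is_svd A U s V"
    and "is_orth_projector n (vec_span n (set (take k (cols U)))) P"
    using PA A by (auto simp: top_left_projector_def)
  then have P: "P = svd_form n U (below k) U"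
    using orth_projector_eq_svd_form k by (auto simp: is_svd_iff_svd_form[OF A])
  obtain U' t V' where svd': "is_svd B U' t V'"
    and "is_orth_projector n (vec_span n (set (take k (cols U')))) P'"
    using PB B by (auto simp: top_left_projector_def)
  then have P': "P' = svd_form n U' (below k) U'"
    using orth_projector_eq_svd_form k by (auto simp: is_svd_iff_svd_form[OF B])
  have U: "orth_mat n U" and V: "orth_mat n V" and s0: "\<And>i. i < n \<Longrightarrow> 0 \<le> s i"
    and s: "\<And>i j. i \<le> j \<Longrightarrow> j < n \<Longrightarrow> s j \<le> s i" and eq: "A = svd_form n U s V"
    using svd by (auto simp: is_svd_iff_svd_form[OF A])
  have U': "orth_mat n U'" and V': "orth_mat n V'" and t0: "\<And>i. i < n \<Longrightarrow> 0 \<le> t i"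
    and t: "\<And>i j. i \<le> j \<Longrightarrow> j < n \<Longrightarrow> t j \<le> t i" and eq': "B = svd_form n U' t V'"
    using svd' by (auto simp: is_svd_iff_svd_form[OF B])
  let ?e = "op_norm (B - A)"
  \<comment> \<open>These are the singular values of \<open>A\<close> with numbers \<open>k\<close>
    and \<open>k + 1\<close>; the default 0 for \<open>k = n\<close> agrees with
    \<open>sing_val\<close>.\<close>
  let ?\<sigma> = "s (k - 1)" and ?\<tau> = "if k < n then s k else 0"
  have e: "op_norm (A - B) = ?e"
  proof -
    have "A - B = - (B - A)" using A B by (intro eq_matI) auto
    then show ?thesis by simp
  qed
  have gap: "sing_val A k - sing_val A (k + 1) = ?\<sigma> - ?\<tau>"
    using k by (auto simp: sing_val_svd[OF A svd])
  have tau0: "0 \<le> ?\<tau>" using s0 by auto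
  \<comment> \<open>Weyl's inequality with the two matrices exchanged, giving a lower bound on the
    \<open>k\<close>-th singular value of \<open>B\<close>.\<close>
  have st: "?\<sigma> \<le> t (k - 1) + ?e"
  proof -
    have "?\<sigma> \<le> \<bar>s j\<bar>" if "j \<le> k - 1" for j
      using s[OF that] s0[of j] that k by auto
    moreover have "\<bar>t j\<bar> \<le> t (k - 1)" if "k - 1 \<le> j" "j < n" for j
      using t[OF that] t0[OF that(2)] by auto
    ultimately have "?\<sigma> \<le> t (k - 1) + op_norm (svd_form n U s V - svd_form n U' t V')"
      using k s0 t0 by (intro singular_value_perturbation[OF U' V' U V]) auto
    then show ?thesis by (simp flip: eq eq' add: e)
  qed
  have ts: "t k \<le> s k + ?e" if kn: "k < n"
  proof -
    have "t k \<le> \<bar>t j\<bar>" if "j \<le> k" for j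
      using t[OF that] t0[of j] that kn by auto
    moreover have "\<bar>s j\<bar> \<le> s k" if "k \<le> j" "j < n" for j
      using s[OF that] s0[OF that(2)] by auto
    ultimately have "t k \<le> s k + op_norm (svd_form n U' t V' - svd_form n U s V)"
      using kn s0 t0 by (intro singular_value_perturbation[OF U V U' V']) auto
    then show ?thesis by (simp flip: eq eq')
  qed
  let ?X = "op_norm (svd_form n U' (from_on k) U' * svd_form n U (below k) U)"
  let ?Y = "op_norm (svd_form n U (from_on k) U * svd_form n U' (below k) U')"
  have "?\<sigma> \<le> s i" if "i < k" for i
    using s[of i "k - 1"] that k by simp
  moreover have "\<bar>t i\<bar> \<le> ?\<tau> + ?e" if "k \<le> i" "i < n" for i
    using t[OF that] t0[OF that(2)] ts that by auto
  ultimately have "(?\<sigma> - (?\<tau> + ?e)) * ?X \<le> op_norm (svd_form n U' t V' - svd_form n U s V)"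
    using tau0 by (intro sin_theta[OF U V U' V']) auto
  then have X: "(?\<sigma> - ?\<tau>) * ?X \<le> ?e + ?e * ?X"
    by (simp flip: eq eq' add: algebra_simps)
  have "?\<sigma> - ?e \<le> t i" if "i < k" for i
    using t[of i "k - 1"] st that k by force
  moreover have "\<bar>s i\<bar> \<le> ?\<tau>" if "k \<le> i" "i < n" for i
    using s[OF that] s0[OF that(2)] that by auto
  ultimately have "((?\<sigma> - ?e) - ?\<tau>) * ?Y \<le> op_norm (svd_form n U s V - svd_form n U' t V')"
    using tau0 by (intro sin_theta[OF U' V' U V]) auto
  then have Y: "(?\<sigma> - ?\<tau>) * ?Y \<le> ?e + ?e * ?Y"
    by (simp flip: eq eq' add: e algebra_simps)
  \<comment> \<open>Cross projections have norm at most 1, so the loss in the gap costs one further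
    \<open>?e\<close> in each direction; this is how 4 arises as 2 + 2.\<close>
  have "?e * ?X \<le> ?e * 1" "?e * ?Y \<le> ?e * 1"
    using op_norm_cross_projection_le_1[OF U U'] op_norm_cross_projection_le_1[OF U' U]
    by (intro mult_left_mono; simp)+
  then have "(?\<sigma> - ?\<tau>) * (?X + ?Y) \<le> 4 * ?e"
    using X Y by (simp only: distrib_left)
  moreover have "0 \<le> ?\<sigma> - ?\<tau>"
    using s[of "k - 1" k] s0[of "k - 1"] k by auto
  then have "(?\<sigma> - ?\<tau>) * op_norm (P' - P) \<le> (?\<sigma> - ?\<tau>) * (?X + ?Y)"
    unfolding P P' by (intro mult_left_mono projector_diff_le[OF U U'])
  ultimately show ?thesis unfolding gap by linarith
qed

text \<open>Right singular vectors of a matrix are left singular vectors of its transpose, while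
  singular values and the norm of the difference are unchanged.\<close>

lemma top_right_projector_perturbation:
  assumes A: "A \<in> carrier_mat n n" and B: "B \<in> carrier_mat n n" and k: "1 \<le> k" "k \<le> n"
    and PA: "top_right_projector k A P" and PB: "top_right_projector k B P'"
  shows "(sing_val A k - sing_val A (k + 1)) * op_norm (P' - P) \<le> 4 * op_norm (B - A)"
proof -
  have left: "top_left_projector k (transpose_mat C) Q"
    if "top_right_projector k C Q" "C \<in> carrier_mat n n" for C Q
    using that is_svd_transpose[OF that(2)]
    unfolding top_left_projector_def top_right_projector_def by fastforce
  \<comment> \<open>Singular values are defined through A^T A, for the transpose through A A^T. A
    decomposition of \<open>A\<close>, supplied by the hypothesis on \<open>P\<close>, shows that
    both give the same list.\<close>
  obtain U s V where "is_svd A U s V" using PA by (auto simp: top_right_projector_def)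
  then have "sing_val (transpose_mat A) i = sing_val A i" for i
    using A by (simp add: sing_val_def singular_values_svd[of A n U s V]
        singular_values_svd[OF _ is_svd_transpose[OF A]])
  moreover have "op_norm (transpose_mat B - transpose_mat A) = op_norm (B - A)"
    using transpose_minus[OF B A] op_norm_transpose[of "B - A"] by simp
  ultimately show ?thesis
    using top_left_projector_perturbation[of "transpose_mat A" n "transpose_mat B" k P P']
      A B k left[OF PA A] left[OF PB B] by simp
qed


section \<open>Convergence in probability\<close>

text \<open>Both sets are replaced by measurable supersets of the same outer measure, for which
  subadditivity is available.\<close>

lemma outer_measure_of_Un_le:
  assumes AB: "A \<subseteq> space M" "B \<subseteq> space M"
  shows "outer_measure_of M (A \<union> B) \<le> outer_measure_of M A + outer_measure_of M B"
proof -
  obtain A' where A': "A' \<in> sets M" "A \<subseteq> A'" "outer_measure_of M A = emeasure M A'"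
    using outer_measure_of_attain[OF AB(1)] by auto
  obtain B' where B': "B' \<in> sets M" "B \<subseteq> B'" "outer_measure_of M B = emeasure M B'"
    using outer_measure_of_attain[OF AB(2)] by auto
  have "outer_measure_of M (A \<union> B) \<le> outer_measure_of M (A' \<union> B')"
    using A' B' by (intro outer_measure_of_mono) auto
  also have "\<dots> = emeasure M (A' \<union> B')" using A' B' by simp
  also have "\<dots> \<le> emeasure M A' + emeasure M B'" using A' B' by (intro emeasure_subadditive)
  finally show ?thesis using A' B' by simp
qed

lemma outer_measure_of_compl_tendsto_0:
  assumes "\<And>N. 1 \<le> N \<Longrightarrow> prob_space (M N)"
    and lim: "(\<lambda>N. measure (M N) {\<omega> \<in> space (M N). Q N \<omega>}) \<longlonglongrightarrow> 1"
  shows "(\<lambda>N. outer_measure_of (M N) {\<omega> \<in> space (M N). \<not> Q N \<omega>}) \<longlonglongrightarrow> 0"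
proof -
  have "(\<lambda>N. ennreal (1 - measure (M N) {\<omega> \<in> space (M N). Q N \<omega>})) \<longlonglongrightarrow> ennreal (1 - 1)"
    by (intro tendsto_intros lim)
  moreover have "eventually (\<lambda>N. 0 < measure (M N) {\<omega> \<in> space (M N). Q N \<omega>}) sequentially"
    using order_tendstoD(1)[OF lim, of 0] by simp
  then have "eventually (\<lambda>N. ennreal (1 - measure (M N) {\<omega> \<in> space (M N). Q N \<omega>}) =
      outer_measure_of (M N) {\<omega> \<in> space (M N). \<not> Q N \<omega>}) sequentially"
    using eventually_ge_at_top[of 1]
  proof eventually_elim
    case (elim N)
    interpret prob_space "M N" using assms(1) elim by blast
    let ?E = "{\<omega> \<in> space (M N). Q N \<omega>}"
    \<comment> \<open>Positive measure certifies that the set is an event, since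
      \<open>measure\<close> is 0 outside \<open>sets\<close>.\<close>
    have E: "?E \<in> sets (M N)" using elim(1) measure_notin_sets[of ?E "M N"] by force
    have "{\<omega> \<in> space (M N). \<not> Q N \<omega>} = space (M N) - ?E" by auto
    then show ?case using E by (simp add: emeasure_eq_measure prob_compl)
  qed
  ultimately show ?thesis by (simp add: tendsto_cong)
qed

text \<open>Where \<open>\<delta>\<close> is positive, the product bound turns |Y| > e into r /
  \<delta> > e / c; the remaining set has vanishing outer measure. No measurability of
  \<open>Y\<close> is assumed, so arbitrary choices of subspaces are covered.\<close>

lemma vanishes_in_prob_div_bound:
  assumes M: "\<And>N. 1 \<le> N \<Longrightarrow> prob_space (M N)"
    and pos: "(\<lambda>N. measure (M N) {\<omega> \<in> space (M N). 0 < \<delta> N \<omega>}) \<longlonglongrightarrow> 1"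
    and van: "vanishes_in_prob M (\<lambda>N \<omega>. r N \<omega> / \<delta> N \<omega>) sequentially"
    and c: "0 < c"
    and le: "\<forall>\<^sub>F N in sequentially. \<forall>\<omega>\<in>space (M N). \<delta> N \<omega> * \<bar>Y N \<omega>\<bar> \<le> c * r N \<omega>"
  shows "vanishes_in_prob M Y sequentially"
  unfolding vanishes_in_prob_def
proof (intro allI impI)
  fix e :: real assume e: "0 < e"
  let ?bad = "\<lambda>N. {\<omega> \<in> space (M N). \<not> 0 < \<delta> N \<omega>}"
  let ?big = "\<lambda>N. {\<omega> \<in> space (M N). e / c < \<bar>r N \<omega> / \<delta> N \<omega>\<bar>}"
  have "(\<lambda>N. outer_measure_of (M N) (?bad N) + outer_measure_of (M N) (?big N)) \<longlonglongrightarrow> 0 + 0"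
    using van e c
    by (intro tendsto_add outer_measure_of_compl_tendsto_0[OF M pos]) (auto simp: vanishes_in_prob_def)
  then have lim: "(\<lambda>N. outer_measure_of (M N) (?bad N) + outer_measure_of (M N) (?big N)) \<longlonglongrightarrow> 0"
    by simp
  have "\<forall>\<^sub>F N in sequentially. outer_measure_of (M N) {\<omega> \<in> space (M N). e < \<bar>Y N \<omega>\<bar>} \<le>
      outer_measure_of (M N) (?bad N) + outer_measure_of (M N) (?big N)"
    using le
  proof eventually_elim
    case (elim N)
    have "{\<omega> \<in> space (M N). e < \<bar>Y N \<omega>\<bar>} \<subseteq> ?bad N \<union> ?big N"
    proof
      fix \<omega> assume w: "\<omega> \<in> {\<omega> \<in> space (M N). e < \<bar>Y N \<omega>\<bar>}"
      show "\<omega> \<in> ?bad N \<union> ?big N"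
      proof (cases "0 < \<delta> N \<omega>")
        case True
        then have "\<delta> N \<omega> * e < \<delta> N \<omega> * \<bar>Y N \<omega>\<bar>" using w by simp
        also have "\<dots> \<le> c * r N \<omega>" using elim w by auto
        finally have "e / c < r N \<omega> / \<delta> N \<omega>" using True c by (simp add: field_simps)
        then have "e / c < \<bar>r N \<omega> / \<delta> N \<omega>\<bar>" by linarith
        then show ?thesis using w by blast
      qed (use w in auto)
    qed
    then have "outer_measure_of (M N) {\<omega> \<in> space (M N). e < \<bar>Y N \<omega>\<bar>} \<le>
        outer_measure_of (M N) (?bad N \<union> ?big N)"
      by (rule outer_measure_of_mono)
    also have "\<dots> \<le> outer_measure_of (M N) (?bad N) + outer_measure_of (M N) (?big N)"
      by (rule outer_measure_of_Un_le) auto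
    finally show ?case .
  qed
  then show "(\<lambda>N. outer_measure_of (M N) {\<omega> \<in> space (M N). e < \<bar>Y N \<omega>\<bar>}) \<longlonglongrightarrow> 0"
    by (intro tendsto_sandwich[OF _ _ tendsto_const lim]) auto
qed

section \<open>Passage from the deterministic bounds to the random layers\<close>

theorem corollary4p11:
  fixes M :: "nat \<Rightarrow> 'w measure"
    and T :: "'s set" and C :: "'s \<Rightarrow> nat" and K :: nat and lam :: real
    and ds :: "nat \<Rightarrow> (nat \<times> nat) list" and q :: "nat \<Rightarrow> nat"
    and X :: "nat \<Rightarrow> 's \<Rightarrow> params \<Rightarrow> real vec"
    and path :: "nat \<Rightarrow> 't::{linorder, no_top} \<Rightarrow> 'w \<Rightarrow> params"
    and astar :: "nat \<Rightarrow> 'w \<Rightarrow> params"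
    and S R :: "nat \<Rightarrow> 'w \<Rightarrow> real mat"
    and psi1 :: "nat \<Rightarrow> remaining_params \<Rightarrow> 's \<Rightarrow> real vec"
    and psi2 :: "nat \<Rightarrow> remaining_params \<Rightarrow> real vec \<Rightarrow> real vec"
    and g :: "nat \<Rightarrow> real"
    and U :: "nat \<Rightarrow> 'w \<Rightarrow> 's \<Rightarrow> real vec set"
    and d1 d2 :: "nat \<Rightarrow> real"
    and J :: "real vec \<Rightarrow> real"
    and eps :: "nat \<Rightarrow> 'w \<Rightarrow> real"
    and k :: nat
    and \<delta> :: "nat \<Rightarrow> 'w \<Rightarrow> real"
    and PWl PSl PWr PSr :: "nat \<Rightarrow> 'w \<Rightarrow> real mat"
  assumes hyps: "gaussian_limit_layer M T C K lam ds q X path astar S R psi1 psi2 g U d1 d2 J eps"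
    and k: "1 \<le> k"
    and gap: "\<And>N \<omega>. \<delta> N \<omega> = sing_val (S N \<omega>) k - sing_val (S N \<omega>) (k + 1)"
    and gap_pos: "(\<lambda>N. measure (M N) {\<omega> \<in> space (M N). 0 < \<delta> N \<omega>}) \<longlonglongrightarrow> 1"
    and noise: "vanishes_in_prob M (\<lambda>N \<omega>. op_norm (R N \<omega>) / \<delta> N \<omega>) sequentially"
    and PWl: "\<And>N \<omega>. 1 \<le> N \<Longrightarrow> k \<le> N \<Longrightarrow> \<omega> \<in> space (M N) \<Longrightarrow>
                top_left_projector k (layer (astar N \<omega>)) (PWl N \<omega>)"
    and PSl: "\<And>N \<omega>. 1 \<le> N \<Longrightarrow> k \<le> N \<Longrightarrow> \<omega> \<in> space (M N) \<Longrightarrow>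
                top_left_projector k (S N \<omega>) (PSl N \<omega>)"
    and PWr: "\<And>N \<omega>. 1 \<le> N \<Longrightarrow> k \<le> N \<Longrightarrow> \<omega> \<in> space (M N) \<Longrightarrow>
                top_right_projector k (layer (astar N \<omega>)) (PWr N \<omega>)"
    and PSr: "\<And>N \<omega>. 1 \<le> N \<Longrightarrow> k \<le> N \<Longrightarrow> \<omega> \<in> space (M N) \<Longrightarrow>
                top_right_projector k (S N \<omega>) (PSr N \<omega>)"
  shows "vanishes_in_prob M (\<lambda>N \<omega>. op_norm (PWl N \<omega> - PSl N \<omega>)) sequentially \<and>
         vanishes_in_prob M (\<lambda>N \<omega>. op_norm (PWr N \<omega> - PSr N \<omega>)) sequentially"
proof -
  interpret gaussian_limit_layer M T C K lam ds q X path astar S R psi1 psi2 g U d1 d2 J eps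
    by (rule hyps)
  have carrier: "S N \<omega> \<in> carrier_mat N N" "R N \<omega> \<in> carrier_mat N N"
    if "1 \<le> N" "\<omega> \<in> space (M N)" for N \<omega>
    using random_S[OF that(1)] random_R[OF that(1)] that(2) by (auto simp: random_mat_def)
  have diff: "layer (astar N \<omega>) \<in> carrier_mat N N" "layer (astar N \<omega>) - S N \<omega> = R N \<omega>"
    if "1 \<le> N" "\<omega> \<in> space (M N)" for N \<omega>
    using carrier[OF that] layer_decomposition[OF that] by auto
  \<comment> \<open>The projectors are prescribed only for widths \<open>N\<close> with
    \<open>k\<close> at most \<open>N\<close>, which suffices for a limit.\<close>
  have large: "\<forall>\<^sub>F N in sequentially. 1 \<le> N \<and> k \<le> N"
    using eventually_ge_at_top[of "max 1 k"] by (rule eventually_mono) simp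
  show ?thesis
  \<comment> \<open>The 4 is the constant of the two projector bounds, applied at each outcome to
    the perturbation of \<open>S N \<omega>\<close> by \<open>R N \<omega>\<close>.\<close>
  proof (intro conjI vanishes_in_prob_div_bound[OF prob_spaces gap_pos noise, of 4])
    show "\<forall>\<^sub>F N in sequentially. \<forall>\<omega>\<in>space (M N).
        \<delta> N \<omega> * \<bar>op_norm (PWl N \<omega> - PSl N \<omega>)\<bar> \<le> 4 * op_norm (R N \<omega>)"
      using large
    proof (rule eventually_mono, intro ballI)
      fix N \<omega> assume N: "1 \<le> N \<and> k \<le> N" and w: "\<omega> \<in> space (M N)"
      then show "\<delta> N \<omega> * \<bar>op_norm (PWl N \<omega> - PSl N \<omega>)\<bar> \<le> 4 * op_norm (R N \<omega>)"
        using top_left_projector_perturbation[OF carrier(1)[of N \<omega>] diff(1)[of N \<omega>] k _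
            PSl[of N \<omega>] PWl[of N \<omega>]]
        by (simp add: gap diff(2))
    qed
    show "\<forall>\<^sub>F N in sequentially. \<forall>\<omega>\<in>space (M N).
        \<delta> N \<omega> * \<bar>op_norm (PWr N \<omega> - PSr N \<omega>)\<bar> \<le> 4 * op_norm (R N \<omega>)"
      using large
    proof (rule eventually_mono, intro ballI)
      fix N \<omega> assume N: "1 \<le> N \<and> k \<le> N" and w: "\<omega> \<in> space (M N)"
      then show "\<delta> N \<omega> * \<bar>op_norm (PWr N \<omega> - PSr N \<omega>)\<bar> \<le> 4 * op_norm (R N \<omega>)"
        using top_right_projector_perturbation[OF carrier(1)[of N \<omega>] diff(1)[of N \<omega>] k _
            PSr[of N \<omega>] PWr[of N \<omega>]]
        by (simp add: gap diff(2))
    qed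
  qed simp_all
qed

end
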